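(* Let $i\in\{0,1\}$, let $(\mu_1^0,\mu_2^0)\in\tau_i^{-}$, and let $n_{-}\bigl(H^{\mathrm{s}}_{\mu_1\mu_2}(0)\bigr)$ be the number of eigenvalues of $H^{\mathrm{s}}_{\mu_1\mu_2}(0)$ below the essential spectrum. Then $$\lim_{\mathcal{A}_i^{-}\ni(\mu_1,\mu_2)\to(\mu_1^0,\mu_2^0)}n_{-}\bigl(H^{\mathrm{s}}_{\mu_1\mu_2}(0)\bigr)=i,\qquad \lim_{\mathcal{A}_{i+1}^{-}\ni(\mu_1,\mu_2)\to(\mu_1^0,\mu_2^0)}n_{-}\bigl(H^{\mathrm{s}}_{\mu_1\mu_2}(0)\bigr)=i+1,$$ and $$n_{-}\bigl(H^{\mathrm{s}}_{\mu_1^0\mu_2^0}(0)\bigr)=i.$$ Moreover, if $(\mu_1^0,\mu_2^0)\in\tau_i^{-}$, $i=0,1$, then the bottom of the essential spectrum $\mathcal{E}_{\min}(0)=0$ is a threshold resonance of the operator $H^{\mathrm{s}}_{\mu_1^0\mu_2^0}(0)$.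
   Context: $\mathbb{T}^3=(\mathbb{R}/2\pi\mathbb{Z})^3$. For $r\in\{1,2\}$, $L^{r,\mathrm{e}}(\mathbb{T}^3)$ is the space of even functions in $L^r(\mathbb{T}^3)$ and $L^{r,\mathrm{e,s}}(\mathbb{T}^3)$ its subspace of functions symmetric under all permutations of $(p_1,p_2,p_3)$. For $\mu_1,\mu_2\in\mathbb{R}$, $$(H_{\mu_1\mu_2}(0)f)(p)=\mathcal{E}_0(p)f(p)+\frac{\mu_1}{(2\pi)^3}\int_{\mathbb{T}^3}f(q)\,dq+\frac{2\mu_2}{(2\pi)^3}\sum_{i=1}^3\cos p_i\int_{\mathbb{T}^3}\cos q_i\,f(q)\,dq,\qquad \mathcal{E}_0(p)=4\sum_{i=1}^3(1-\cos p_i),$$ which is a bounded self-adjoint operator on $L^{2,\mathrm{e}}(\mathbb{T}^3)$ with essential spectrum $[0,24]$, so $\mathcal{E}_{\min}(0)=\min\mathcal{E}_0=0$; the same formula defines a bounded operator on $L^{1,\mathrm{e}}(\mathbb{T}^3)$. $H^{\mathrm{s}}_{\mu_1\mu_2}(0)$ is the restriction of $H_{\mu_1\mu_2}(0)$ to the reducing subspace $L^{2,\mathrm{e,s}}(\mathbb{T}^3)$. Eigenvalues are counted with multiplicity. Threshold resonance: $\mathcal{E}_{\min}(0)$ is a threshold resonance of $H^{\mathrm{s}}_{\mu_1\mu_2}(0)$ if $H_{\mu_1\mu_2}(0)f=\mathcal{E}_{\min}(0)f$ has a non-trivial solution $f\in L^{1,\mathrm{e,s}}(\mathbb{T}^3)\setminus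 L^{2,\mathrm{e,s}}(\mathbb{T}^3)$. Let $a^{\mathrm{s}}_{11}(0)=\frac{1}{8\pi^3}\int_{\mathbb{T}^3}\frac{dp}{\mathcal{E}_0(p)}$, $\mu_0=\frac{24\,a^{\mathrm{s}}_{11}(0)}{12\,a^{\mathrm{s}}_{11}(0)-1}$ (where $12a^{\mathrm{s}}_{11}(0)-1>0$), and $\mu_2^{-}(\mu_1)=\frac{24}{\mu_1+12}-\mu_0$ for $\mu_1\neq-12$. Then $\tau_0^{-}=\{\mu_1>-12,\ \mu_2=\mu_2^{-}(\mu_1)\}$, $\tau_1^{-}=\{\mu_1<-12,\ \mu_2=\mu_2^{-}(\mu_1)\}$; $\mathcal{A}_0^{-}=\{\mu_1>-12,\ \mu_2>\mu_2^{-}(\mu_1)\}$; $\mathcal{A}_1^{-}=\{\mu_1>-12,\ \mu_2<\mu_2^{-}(\mu_1)\}\cup\{\mu_1<-12,\ \mu_2>\mu_2^{-}(\mu_1)\}\cup\{(-12,\mu_2):\mu_2\in\mathbb{R}\}$; $\mathcal{A}_2^{-}=\{\mu_1<-12,\ \mu_2<\mu_2^{-}(\mu_1)\}$. *)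

theory Defs
  imports "HOL-Analysis.Analysis"
begin

text \<open>
  The torus is represented by its fundamental domain, the closed cube with side from -pi to pi.
  The cube is invariant under p -> -p and under permutations of the coordinates, and the
  identifications on its boundary only concern a null set. The elements of the Lebesgue spaces
  are complex-valued measurable functions, and equality of such elements is always stated
  almost everywhere.
\<close>

definition torus :: "(real^3) set" where
  "torus = cbox (\<chi> i. - pi) (\<chi> i. pi)"

abbreviation T3 :: "(real^3) measure" where
  "T3 \<equiv> lebesgue_on torus"

type_synonym torus_fun = "real^3 \<Rightarrow> complex"

definition Lr_even :: "nat \<Rightarrow> torus_fun set" where
  "Lr_even r = {f \<in> borel_measurable T3.
     integrable T3 (\<lambda>p. norm (f p) ^ r) \<and> (AE p in T3. f (- p) = f p)}"

definition Lr_even_sym :: "nat \<Rightarrow> torus_fun set" where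
  "Lr_even_sym r = {f \<in> Lr_even r.
     \<forall>s::3 \<Rightarrow> 3. bij s \<longrightarrow> (AE p in T3. f (\<chi> i. p $ s i) = f p)}"

definition L2norm :: "torus_fun \<Rightarrow> real" where
  "L2norm f = sqrt (LINT p|T3. (norm (f p))\<^sup>2)"

text \<open>
  Spectral theory of an operator A acting on a space V of square-integrable functions. All the
  operators to which this is applied are self-adjoint, so their spectra are real and only real
  spectral parameters are considered.
\<close>

definition eigenspace ::
  "(torus_fun \<Rightarrow> torus_fun) \<Rightarrow> torus_fun set \<Rightarrow> real \<Rightarrow> torus_fun set" where
  "eigenspace A V e = {f \<in> V. AE p in T3. A f p = of_real e * f p}"

definition eigenvalue :: "(torus_fun \<Rightarrow> torus_fun) \<Rightarrow> torus_fun set \<Rightarrow> real \<Rightarrow> bool" where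
  "eigenvalue A V e \<longleftrightarrow> (\<exists>f \<in> eigenspace A V e. \<not> (AE p in T3. f p = 0))"

definition lin_indep_ae :: "nat \<Rightarrow> (nat \<Rightarrow> torus_fun) \<Rightarrow> bool" where
  "lin_indep_ae n f \<longleftrightarrow>
     (\<forall>c::nat \<Rightarrow> complex. (AE p in T3. (\<Sum>j<n. c j * f j p) = 0) \<longrightarrow> (\<forall>j<n. c j = 0))"

text \<open>The complex dimension, possibly infinite, of the eigenspace modulo null functions.\<close>

definition multiplicity_ev ::
  "(torus_fun \<Rightarrow> torus_fun) \<Rightarrow> torus_fun set \<Rightarrow> real \<Rightarrow> enat" where
  "multiplicity_ev A V e =
     (SUP n \<in> {n. \<exists>f. (\<forall>j<n. f j \<in> eigenspace A V e) \<and> lin_indep_ae n f}. enat n)"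

text \<open>
  The number z belongs to the resolvent set if A - z maps V onto V and has a bounded inverse;
  injectivity modulo null functions and boundedness of the inverse are both expressed by the
  lower bound on A - z.
\<close>

definition resolvent_set :: "(torus_fun \<Rightarrow> torus_fun) \<Rightarrow> torus_fun set \<Rightarrow> real set" where
  "resolvent_set A V = {z.
     (\<forall>g \<in> V. \<exists>f \<in> V. AE p in T3. A f p - of_real z * f p = g p) \<and>
     (\<exists>C. \<forall>f \<in> V. L2norm f \<le> C * L2norm (\<lambda>p. A f p - of_real z * f p))}"

definition spectrum :: "(torus_fun \<Rightarrow> torus_fun) \<Rightarrow> torus_fun set \<Rightarrow> real set" where
  "spectrum A V = - resolvent_set A V"

definition discrete_spectrum :: "(torus_fun \<Rightarrow> torus_fun) \<Rightarrow> torus_fun set \<Rightarrow> real set" where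
  "discrete_spectrum A V = {e. e isolated_in (spectrum A V) \<and>
     eigenvalue A V e \<and> multiplicity_ev A V e \<noteq> \<infinity>}"

definition essential_spectrum :: "(torus_fun \<Rightarrow> torus_fun) \<Rightarrow> torus_fun set \<Rightarrow> real set" where
  "essential_spectrum A V = spectrum A V - discrete_spectrum A V"

definition eigenvalues_below_ess ::
  "(torus_fun \<Rightarrow> torus_fun) \<Rightarrow> torus_fun set \<Rightarrow> real set" where
  "eigenvalues_below_ess A V =
     {e. eigenvalue A V e \<and> (\<forall>z \<in> essential_spectrum A V. e < z)}"

text \<open>
  The supremum over finite subsets is the sum of the multiplicities over a possibly infinite
  set of eigenvalues.
\<close>

definition n_minus :: "(torus_fun \<Rightarrow> torus_fun) \<Rightarrow> torus_fun set \<Rightarrow> enat" where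
  "n_minus A V =
     (SUP F \<in> {F. finite F \<and> F \<subseteq> eigenvalues_below_ess A V}. \<Sum>e\<in>F. multiplicity_ev A V e)"

definition E0 :: "real^3 \<Rightarrow> real" where
  "E0 p = 4 * (\<Sum>i\<in>UNIV. 1 - cos (p $ i))"

definition E_min :: real where
  "E_min = Inf (E0 ` torus)"

definition H :: "real \<Rightarrow> real \<Rightarrow> torus_fun \<Rightarrow> torus_fun" where
  "H \<mu>\<^sub>1 \<mu>\<^sub>2 f p =
     of_real (E0 p) * f p
     + of_real (\<mu>\<^sub>1 / (2 * pi) ^ 3) * (LINT q|T3. f q)
     + of_real (2 * \<mu>\<^sub>2 / (2 * pi) ^ 3) *
         (\<Sum>i\<in>UNIV. of_real (cos (p $ i)) * (LINT q|T3. of_real (cos (q $ i)) * f q))"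

text \<open>The counting function of the restriction of H to the symmetric subspace.\<close>

definition n_minus_sym :: "real \<Rightarrow> real \<Rightarrow> enat" where
  "n_minus_sym \<mu>\<^sub>1 \<mu>\<^sub>2 = n_minus (H \<mu>\<^sub>1 \<mu>\<^sub>2) (Lr_even_sym 2)"

text \<open>Membership in L1 but not in L2 already makes the solution non-trivial.\<close>

definition threshold_resonance_sym :: "real \<Rightarrow> real \<Rightarrow> bool" where
  "threshold_resonance_sym \<mu>\<^sub>1 \<mu>\<^sub>2 \<longleftrightarrow>
     (\<exists>f \<in> Lr_even_sym 1 - Lr_even_sym 2. AE p in T3. H \<mu>\<^sub>1 \<mu>\<^sub>2 f p = of_real E_min * f p)"

definition a11 :: real where
  "a11 = 1 / (8 * pi ^ 3) * (LINT p|T3. 1 / E0 p)"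

definition \<mu>\<^sub>0 :: real where
  "\<mu>\<^sub>0 = 24 * a11 / (12 * a11 - 1)"

definition \<mu>\<^sub>2_minus :: "real \<Rightarrow> real" where
  "\<mu>\<^sub>2_minus \<mu>\<^sub>1 = 24 / (\<mu>\<^sub>1 + 12) - \<mu>\<^sub>0"

fun \<tau>_minus :: "nat \<Rightarrow> (real \<times> real) set" where
  "\<tau>_minus 0 = {(\<mu>\<^sub>1, \<mu>\<^sub>2). \<mu>\<^sub>1 > - 12 \<and> \<mu>\<^sub>2 = \<mu>\<^sub>2_minus \<mu>\<^sub>1}"
| "\<tau>_minus (Suc 0) = {(\<mu>\<^sub>1, \<mu>\<^sub>2). \<mu>\<^sub>1 < - 12 \<and> \<mu>\<^sub>2 = \<mu>\<^sub>2_minus \<mu>\<^sub>1}"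
| "\<tau>_minus (Suc (Suc _)) = {}"

fun A_minus :: "nat \<Rightarrow> (real \<times> real) set" where
  "A_minus 0 = {(\<mu>\<^sub>1, \<mu>\<^sub>2). \<mu>\<^sub>1 > - 12 \<and> \<mu>\<^sub>2 > \<mu>\<^sub>2_minus \<mu>\<^sub>1}"
| "A_minus (Suc 0) =
     {(\<mu>\<^sub>1, \<mu>\<^sub>2). \<mu>\<^sub>1 > - 12 \<and> \<mu>\<^sub>2 < \<mu>\<^sub>2_minus \<mu>\<^sub>1}
     \<union> {(\<mu>\<^sub>1, \<mu>\<^sub>2). \<mu>\<^sub>1 < - 12 \<and> \<mu>\<^sub>2 > \<mu>\<^sub>2_minus \<mu>\<^sub>1}
     \<union> {(\<mu>\<^sub>1, \<mu>\<^sub>2). \<mu>\<^sub>1 = - 12}"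
| "A_minus (Suc (Suc 0)) = {(\<mu>\<^sub>1, \<mu>\<^sub>2). \<mu>\<^sub>1 < - 12 \<and> \<mu>\<^sub>2 < \<mu>\<^sub>2_minus \<mu>\<^sub>1}"
| "A_minus (Suc (Suc (Suc _))) = {}"

end

theory Submission
  imports Defs
begin

text \<open>
  On symmetric functions \<open>H\<close> is multiplication by \<open>E0 = 12 - 4 C\<close>, where \<open>C\<close> is the sum of the cosines,
  plus a perturbation of rank two built on \<open>1\<close> and \<open>C\<close>. For \<open>z < 0\<close> put \<open>w = 12 - z\<close>. Every solution
  of \<open>H f = z f\<close> is a multiple of \<open>1 / (w - 4 C) + \<mu>\<^sub>2 B / 6\<close>, with \<open>A\<close> and \<open>B\<close> the averages of \<open>1 / (w - 4 C)\<close>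
  and \<open>C / (w - 4 C)\<close>, so eigenvalues are simple. They occur exactly at the zeros of a determinant,
  which by \<open>4 B = w A - 1\<close> are the solutions of \<open>(w + \<mu>\<^sub>1) (m w + \<mu>\<^sub>2) = 24\<close> with \<open>m = 6 A / B\<close>.
  By Cauchy-Schwarz \<open>m\<close> increases, and it tends to infinity, so there is at most one solution with
  both factors positive and at most one with both negative. Whether they exist is decided by the
  signs at \<open>w = 12\<close>, where \<open>m = \<mu>\<^sub>0\<close> and the equation is that of the threshold curve. On that curve
  the same formula at \<open>w = 12\<close> gives the resonance \<open>1 / E0 + \<mu>\<^sub>2 B / 6\<close>, which is integrable but not
  square integrable, since \<open>E0\<close> vanishes quadratically at a point of a three-dimensional torus.
\<close>

section \<open>Lebesgue measure on the torus\<close>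

text \<open>The count refers to the essential spectrum, which is defined through isolated points of
  the spectrum and is not known in advance. Two facts about the spectrum itself are therefore
  needed: off the zeros of the determinant the negative axis carries a bounded inverse, and all of
  \<open>[0, 24)\<close> is spectrum, by trial functions that the perturbation annihilates. Together
  they put the bottom at zero, so that "below" means negative. The determinant is not visibly
  monotone in \<open>w\<close>. Divided by \<open>gB w / 6\<close> it becomes a product of a
  strictly increasing and a nondecreasing factor, minus 24, so the common sign of the factors labels
  the roots, and crossing a threshold curve means that one root passes through
  \<open>w = 12\<close>. Because \<open>1 / E0\<close> is integrable in three dimensions, every
  identity for \<open>A\<close> and \<open>B\<close> holds on the closed half-line
  \<open>w \<ge> 12\<close>. The threshold is thus an ordinary member of the family and not a
  limiting case. The count is constant on each region, so the two limits require no perturbation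
  theory.\<close>

lemma distr_lebesgue_eq:
  fixes T :: "'a::euclidean_space \<Rightarrow> 'a"
  assumes T [measurable]: "T \<in> borel \<rightarrow>\<^sub>M borel" and distr: "distr lborel borel T = lborel"
  shows "T \<in> lebesgue \<rightarrow>\<^sub>M lebesgue" and "distr lebesgue lebesgue T = lebesgue"
proof -
  have T': "T \<in> lborel \<rightarrow>\<^sub>M lborel" by simp
  have d: "distr lebesgue lborel T = lborel"
    using distr_completion[OF T'] distr by (simp cong: distr_cong)
  \<comment> \<open>A Borel map could pull a null set back to a non-measurable set. This one
    preserves \<open>lborel\<close>, so preimages of null sets are null and measurability passes to
    the completion.\<close>
  then show "T \<in> lebesgue \<rightarrow>\<^sub>M lebesgue"
    by (simp add: completion.measurable_completion2 measurable_completion)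
  have "lebesgue = completion (distr lebesgue lborel T)" using d by simp
  also have "\<dots> = distr lebesgue lebesgue T"
    by (subst completion.completion_distr_eq) (auto simp: d measurable_completion)
  finally show "distr lebesgue lebesgue T = lebesgue" ..
qed

lemma emeasure_lborel_box_cart:
  fixes l u :: "real^'n"
  assumes "\<And>i. l $ i \<le> u $ i"
  shows "emeasure lborel (box l u) = ennreal (\<Prod>i\<in>UNIV. u $ i - l $ i)"
proof -
  have "emeasure lborel (box l u) = emeasure lborel (cbox l u)"
    by (simp add: emeasure_lborel_box_eq emeasure_lborel_cbox_eq)
  also have "\<dots> = ennreal (measure lborel (cbox l u))"
    using emeasure_lborel_cbox_finite[of l u] by (intro emeasure_eq_ennreal_measure) auto
  also have "measure lborel (cbox l u) = (\<Prod>i\<in>UNIV. u $ i - l $ i)"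
    using assms by (intro content_cbox_cart) (auto simp: mem_box_cart interval_ne_empty_cart)
  finally show ?thesis .
qed

lemma lborel_distr_permute:
  fixes s :: "'n::finite \<Rightarrow> 'n"
  assumes "bij s"
  shows "distr lborel borel (\<lambda>p::real^'n. \<chi> i. p $ s i) = lborel"
proof (rule lborel_eqI[symmetric])
  let ?T = "\<lambda>p::real^'n. \<chi> i. p $ s i"
  have T [measurable]: "?T \<in> borel \<rightarrow>\<^sub>M borel"
    by (intro borel_measurable_continuous_onI continuous_intros)
  fix l u :: "real^'n" assume le: "\<And>b. b \<in> Basis \<Longrightarrow> l \<bullet> b \<le> u \<bullet> b"
  have le': "l $ i \<le> u $ i" for i using le[of "axis i 1"] by (simp add: inner_axis)
  have bij: "bij (inv s)" using assms by (rule bij_imp_bij_inv)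
  have inv: "inv s (s i) = i" "s (inv s i) = i" for i
    using assms by (auto simp: bij_is_inj bij_is_surj surj_f_inv_f)
  have "?T -` box l u = box (\<chi> i. l $ inv s i) (\<chi> i. u $ inv s i)"
  proof (intro set_eqI)
    fix p
    have "p \<in> ?T -` box l u \<longleftrightarrow> (\<forall>i. l $ i < p $ s i \<and> p $ s i < u $ i)"
      by (simp add: mem_box_cart)
    also have "\<dots> \<longleftrightarrow> (\<forall>j. l $ inv s j < p $ j \<and> p $ j < u $ inv s j)"
      using inv by metis
    finally show "p \<in> ?T -` box l u \<longleftrightarrow> p \<in> box (\<chi> i. l $ inv s i) (\<chi> i. u $ inv s i)"
      by (simp add: mem_box_cart)
  qed
  then have "emeasure (distr lborel borel ?T) (box l u)
      = emeasure lborel (box (\<chi> i. l $ inv s i) (\<chi> i. u $ inv s i))"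
    by (simp add: emeasure_distr)
  also have "\<dots> = ennreal (\<Prod>i\<in>UNIV. u $ inv s i - l $ inv s i)"
    using le' by (subst emeasure_lborel_box_cart) auto
  also have "(\<Prod>i\<in>UNIV. u $ inv s i - l $ inv s i) = (\<Prod>i\<in>UNIV. u $ i - l $ i)"
    using prod.reindex_bij_betw[OF bij, of "\<lambda>i. u $ i - l $ i"] by simp
  also have "ennreal \<dots> = emeasure lborel (box l u)"
    using le' by (simp add: emeasure_lborel_box_cart)
  also have "\<dots> = (\<Prod>b\<in>Basis. (u - l) \<bullet> b)"
    using le by (simp add: emeasure_lborel_box_eq)
  finally show "emeasure (distr lborel borel ?T) (box l u) = (\<Prod>b\<in>Basis. (u - l) \<bullet> b)" .
qed simp

lemma mem_torus: "p \<in> torus \<longleftrightarrow> (\<forall>i. - pi \<le> p $ i \<and> p $ i \<le> pi)"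
  by (simp add: torus_def mem_box_cart)

lemma torus_lmeasurable [simp, intro]: "torus \<in> lmeasurable" "torus \<in> sets lebesgue"
  by (auto simp: torus_def)

interpretation T3: finite_measure T3
  by (intro finite_measure_lebesgue_on torus_lmeasurable)

lemma measure_T3: "measure T3 torus = (2 * pi) ^ 3"
proof -
  have "measure T3 torus = measure lborel torus"
    by (simp add: measure_restrict_space torus_def)
  also have "\<dots> = (2 * pi) ^ 3"
    unfolding torus_def by (subst content_cbox_cart) (auto simp: interval_ne_empty_cart)
  finally show ?thesis .
qed

text \<open>Serves to identify the three cosine moments of a symmetric function, which is what
  reduces the perturbation to rank two.\<close>

lemma integral_permute_T3:
  fixes f :: "real^3 \<Rightarrow> 'b::{banach, second_countable_topology}"
  assumes s: "bij s" and f: "f \<in> borel_measurable T3"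
  shows "(LINT p|T3. f (\<chi> i. p $ s i)) = (LINT p|T3. f p)"
proof -
  let ?T = "\<lambda>p::real^3. \<chi> i. p $ s i"
  have T: "?T \<in> borel \<rightarrow>\<^sub>M borel"
    by (intro borel_measurable_continuous_onI continuous_intros)
  note inv = distr_lebesgue_eq[OF T lborel_distr_permute[OF s]]
  have torus: "indicator torus (?T p) = (indicator torus p :: real)" for p
  proof -
    have "?T p \<in> torus \<longleftrightarrow> p \<in> torus"
      unfolding mem_torus vec_lambda_beta using bij_is_surj[OF s] by (metis surjD)
    then show ?thesis by (simp add: indicator_def)
  qed
  have "(LINT p|T3. f p) = (LINT p|lebesgue. indicator torus p *\<^sub>R f p)"
    by (simp add: integral_restrict_space)
  also have "\<dots> = (LINT p|distr lebesgue lebesgue ?T. indicator torus p *\<^sub>R f p)"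
    by (simp only: inv)
  also have "\<dots> = (LINT p|lebesgue. indicator torus (?T p) *\<^sub>R f (?T p))"
    using f by (intro integral_distr inv) (simp add: borel_measurable_restrict_space_iff)
  also have "\<dots> = (LINT p|T3. f (?T p))"
    by (simp add: integral_restrict_space torus)
  finally show ?thesis ..
qed

section \<open>The sum of the cosines and its mean value\<close>

definition csum :: "real^3 \<Rightarrow> real" where
  "csum p = (\<Sum>i\<in>UNIV. cos (p $ i))"

lemma continuous_csum: "continuous_on S csum"
  unfolding csum_def by (intro continuous_intros)

lemma csum_measurable [measurable]: "csum \<in> borel_measurable T3"
  by (intro continuous_imp_measurable_on_sets_lebesgue continuous_csum) simp

lemma cos_measurable_T3 [measurable]: "(\<lambda>p. cos (p $ i)) \<in> borel_measurable T3"
  by (intro continuous_imp_measurable_on_sets_lebesgue continuous_intros) simp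

lemma E0_eq: "E0 p = 12 - 4 * csum p"
  by (simp add: E0_def csum_def sum_subtractf)

lemma E0_measurable [measurable]: "E0 \<in> borel_measurable T3"
  unfolding E0_eq by measurable

lemma csum_bounds: "\<bar>csum p\<bar> \<le> 3"
proof -
  have "\<bar>csum p\<bar> \<le> (\<Sum>i\<in>(UNIV::3 set). 1)"
    unfolding csum_def by (intro order_trans[OF sum_abs] sum_mono) simp
  then show ?thesis by simp
qed

text \<open>A shift by \<open>pi\<close> in coordinate \<open>i\<close> carries the half
  \<open>L\<close> of the cube onto the half \<open>R\<close> and reverses the sign of the cosine,
  so the two halves cancel. They overlap only in a hyperplane, a null set.\<close>

lemma integral_cos_T3: "(LINT p|T3. cos (p $ i)) = 0"
proof -
  let ?a = "axis i pi :: real^3"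
  define L where "L = {p \<in> torus. p $ i \<le> 0}"
  define R where "R = {p \<in> torus. p $ i \<ge> 0}"
  have sets_LR [measurable]: "L \<in> sets lebesgue" "R \<in> sets lebesgue"
  proof -
    have "L = torus \<inter> {p. p $ i \<le> 0}" "R = torus \<inter> {p. p $ i \<ge> 0}"
      by (auto simp: L_def R_def)
    moreover have "closed {p::real^3. p $ i \<le> 0}" "closed {p::real^3. p $ i \<ge> 0}"
      by (intro closed_Collect_le continuous_intros)+
    ultimately show "L \<in> sets lebesgue" "R \<in> sets lebesgue" by auto
  qed
  have [measurable]: "(\<lambda>p::real^3. cos (p $ i)) \<in> borel_measurable lebesgue"
    using continuous_imp_measurable_on_sets_lebesgue[of UNIV "\<lambda>p::real^3. cos (p $ i)"]
    by (simp add: continuous_intros)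
  have int: "integrable lebesgue (\<lambda>p. indicator A p *\<^sub>R cos (p $ i))"
    if "A \<subseteq> torus" and [measurable]: "A \<in> sets lebesgue" for A
  proof (rule Bochner_Integration.integrable_bound[of _ "indicator torus :: _ \<Rightarrow> real"])
    show "integrable lebesgue (indicator torus :: _ \<Rightarrow> real)"
      using torus_lmeasurable(1) by (simp add: fmeasurable_def)
  qed (use that in \<open>auto simp: indicator_def\<close>)
  have "(+) ?a \<in> borel \<rightarrow>\<^sub>M borel" by simp
  note inv = distr_lebesgue_eq[OF this lborel_distr_plus]
  have "AE p in lebesgue. p \<notin> {p::real^3. p $ i = 0}"
    by (rule AE_not_in) (use negligible_standard_hyperplane_cart[of i] in \<open>auto simp: negligible_iff_null_sets\<close>)
  then have AE: "AE p in lebesgue. indicator torus p *\<^sub>R cos (p $ i)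
      = indicator L p *\<^sub>R cos (p $ i) + indicator R p *\<^sub>R cos (p $ i)"
    by (rule AE_mp) (auto intro!: AE_I2 simp: L_def R_def indicator_def)
  have R_iff: "?a + p \<in> R \<longleftrightarrow> p \<in> L" for p
  proof -
    have comp: "(?a + p) $ j = (if j = i then pi + p $ i else p $ j)" for j
      by (simp add: axis_def)
    have "?a + p \<in> R \<longleftrightarrow> (\<forall>j. j \<noteq> i \<longrightarrow> - pi \<le> p $ j \<and> p $ j \<le> pi) \<and> - pi \<le> p $ i \<and> p $ i \<le> 0"
      (is "_ \<longleftrightarrow> ?Q")
    proof
      assume *: "?a + p \<in> R"
      have "- pi \<le> p $ j \<and> p $ j \<le> pi" if "j \<noteq> i" for j
        using * that comp[of j] unfolding R_def mem_torus by (metis (no_types, lifting) mem_Collect_eq)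
      moreover have "(?a + p) $ i \<ge> 0" "(?a + p) $ i \<le> pi"
        using * unfolding R_def mem_torus by blast+
      ultimately show ?Q using comp[of i] by simp
    next
      assume Q: ?Q
      have "- pi \<le> (?a + p) $ j \<and> (?a + p) $ j \<le> pi" for j
        using Q pi_gt_zero unfolding comp by (cases "j = i") auto
      then show "?a + p \<in> R" using Q comp[of i] by (simp add: R_def mem_torus)
    qed
    also have "\<dots> \<longleftrightarrow> p \<in> L"
    proof
      assume Q: ?Q
      have "- pi \<le> p $ j \<and> p $ j \<le> pi" for j
        using Q pi_gt_zero by (cases "j = i") auto
      then show "p \<in> L" using Q by (simp add: L_def mem_torus)
    qed (simp add: L_def mem_torus)
    finally show ?thesis .
  qed
  have shift: "indicator R (?a + p) = (indicator L p :: real)" for p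
    unfolding indicator_def using R_iff by simp
  have "(LINT p|lebesgue. indicator R p *\<^sub>R cos (p $ i))
      = (LINT p|distr lebesgue lebesgue ((+) ?a). indicator R p *\<^sub>R cos (p $ i))"
    by (simp only: inv)
  also have "\<dots> = (LINT p|lebesgue. indicator R (?a + p) *\<^sub>R cos ((?a + p) $ i))"
    by (intro integral_distr inv) measurable
  also have "\<dots> = - (LINT p|lebesgue. indicator L p *\<^sub>R cos (p $ i))"
    by (simp add: shift add.commute[of pi])
  finally have "(LINT p|lebesgue. indicator L p *\<^sub>R cos (p $ i))
      + (LINT p|lebesgue. indicator R p *\<^sub>R cos (p $ i)) = 0" by simp
  moreover have "(LINT p|T3. cos (p $ i)) = (LINT p|lebesgue. indicator torus p *\<^sub>R cos (p $ i))"
    by (simp add: integral_restrict_space)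
  moreover have "\<dots> = (LINT p|lebesgue. indicator L p *\<^sub>R cos (p $ i) + indicator R p *\<^sub>R cos (p $ i))"
    by (intro integral_cong_AE AE borel_measurable_scaleR borel_measurable_add borel_measurable_indicator) auto
  moreover have "\<dots> = (LINT p|lebesgue. indicator L p *\<^sub>R cos (p $ i))
      + (LINT p|lebesgue. indicator R p *\<^sub>R cos (p $ i))"
    by (intro Bochner_Integration.integral_add int) (simp_all add: sets_LR, auto simp: L_def R_def)
  ultimately show ?thesis by simp
qed

lemma measure_T3_pos:
  assumes "open U" and "x \<in> U" and "\<And>i. - pi < x $ i \<and> x $ i < pi"
  shows "measure T3 (U \<inter> torus) > 0"
proof -
  let ?b = "box (\<chi> i. - pi) (\<chi> i. pi) :: (real^3) set"
  have sub: "?b \<subseteq> torus" unfolding torus_def by (rule box_subset_cbox)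
  have "x \<in> U \<inter> ?b" using assms by (auto simp: mem_box_cart)
  then have "\<not> negligible (U \<inter> ?b)"
    using assms by (intro open_not_negligible open_Int open_box) auto
  moreover have b: "U \<inter> ?b \<in> lmeasurable"
    by (intro fmeasurable_Int_fmeasurable bounded_set_imp_lmeasurable)
       (use assms in \<open>auto intro: bounded_subset\<close>)
  ultimately have "measure lebesgue (U \<inter> ?b) > 0"
    by (simp add: negligible_iff_measure zero_less_measure_iff)
  also have "\<dots> \<le> measure lebesgue (U \<inter> torus)"
  proof (rule measure_mono_fmeasurable)
    show "U \<inter> torus \<in> lmeasurable"
      using assms(1) by (subst Int_commute) (intro fmeasurable_Int_fmeasurable torus_lmeasurable, auto)
  qed (use sub b in auto)
  also have "\<dots> = measure T3 (U \<inter> torus)" by (subst measure_restrict_space) auto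
  finally show ?thesis .
qed

text \<open>Turns an almost-everywhere identity into one at a point of a chosen open set, where it
  can be contradicted.\<close>

lemma AE_T3_ex:
  assumes "AE p in T3. P p" and "open U" and "x \<in> U" and "\<And>i. - pi < x $ i \<and> x $ i < pi"
  shows "\<exists>p \<in> U. P p"
proof (rule ccontr)
  assume no: "\<not> ?thesis"
  have "AE p in T3. p \<notin> U \<inter> torus"
    using assms(1) by (rule AE_mp) (use no in \<open>auto intro!: AE_I2\<close>)
  moreover have sets: "U \<inter> torus \<in> sets T3" using assms(2) by (auto simp: sets_restrict_space)
  ultimately have "emeasure T3 (U \<inter> torus) = 0"
    by (subst (asm) AE_iff_measurable[OF sets]) (auto simp: sets.sets_into_space)
  then show False using measure_T3_pos[OF assms(2-4)] by (simp add: measure_def)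
qed

lemma AE_T3_nonzero: "AE p in T3. p \<in> torus \<and> p \<noteq> 0"
proof -
  have "negligible {0::real^3}" by simp
  then have "AE p in lebesgue. p \<notin> {0::real^3}"
    by (intro AE_not_in) (simp add: negligible_iff_null_sets)
  then show ?thesis by (subst AE_restrict_space_iff) (auto elim: AE_mp)
qed

section \<open>The singularity of the inverse dispersion\<close>

text \<open>Dyadic layers replace polar coordinates. Between consecutive cubes \<open>E0\<close> is
  of order \<open>1 / 4 ^ k\<close> on a volume of order \<open>1 / 8 ^ k\<close>, so
  \<open>1 / E0\<close> contributes about \<open>1 / 2 ^ k\<close> to its integral, and its square
  about \<open>2 ^ k\<close>.\<close>

definition dyadic_cube :: "nat \<Rightarrow> (real^3) set" where
  "dyadic_cube k = cbox (\<chi> i. - (pi / 2 ^ k)) (\<chi> i. pi / 2 ^ k)"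

lemma mem_dyadic_cube: "p \<in> dyadic_cube k \<longleftrightarrow> (\<forall>i. \<bar>p $ i\<bar> \<le> pi / 2 ^ k)"
  by (auto simp: dyadic_cube_def mem_box_cart abs_le_iff minus_le_iff)

lemma dyadic_cube_subset: "dyadic_cube k \<subseteq> torus"
proof
  fix p assume p: "p \<in> dyadic_cube k"
  have "pi / 2 ^ k \<le> pi" by (simp add: divide_le_eq)
  then have "\<bar>p $ i\<bar> \<le> pi" for i using p unfolding mem_dyadic_cube by (meson order_trans)
  then show "p \<in> torus" unfolding mem_torus by (auto simp: abs_le_iff minus_le_iff)
qed

lemma sets_dyadic_cube [measurable]: "dyadic_cube k \<in> sets T3"
  using dyadic_cube_subset by (auto simp: sets_restrict_space_iff dyadic_cube_def)

lemma emeasure_dyadic_cube: "emeasure T3 (dyadic_cube k) = ennreal ((2 * pi) ^ 3 / 8 ^ k)"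
proof -
  have "emeasure T3 (dyadic_cube k) = emeasure lebesgue (dyadic_cube k)"
    using dyadic_cube_subset by (intro emeasure_restrict_space) auto
  also have "\<dots> = emeasure lborel (box (\<chi> i. - (pi / 2 ^ k)) (\<chi> i. pi / 2 ^ k) :: (real^3) set)"
    by (simp add: dyadic_cube_def emeasure_lborel_box_eq emeasure_lborel_cbox_eq)
  also have "\<dots> = ennreal ((2 * (pi / 2 ^ k)) ^ 3)"
    by (subst emeasure_lborel_box_cart) auto
  also have "(2 * (pi / 2 ^ k)) ^ 3 = (2 * pi) ^ 3 / (8 ^ k :: real)"
    by (simp add: power_mult_distrib power_divide power_mult[symmetric] mult.commute[of k]) (simp add: power_mult)
  finally show ?thesis .
qed

text \<open>Halving the angle divides \<open>1 - cos\<close> by at most four.\<close>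

lemma one_minus_cos_dyadic: "1 - cos (pi / 2 ^ k) \<ge> 2 / 4 ^ k"
proof (induction k)
  case (Suc k)
  define c where "c = cos (pi / 2 ^ Suc k)"
  have "cos (pi / 2 ^ k) = 2 * c\<^sup>2 - 1"
    using cos_double_cos[of "pi / 2 ^ Suc k"] by (simp add: c_def)
  moreover have "1 - (2 * c\<^sup>2 - 1) = 2 * (1 - c) * (1 + c)" by (simp add: power2_eq_square algebra_simps)
  moreover have "\<dots> \<le> 2 * (1 - c) * 2"
    by (intro mult_left_mono) (auto simp: c_def)
  ultimately show ?case using Suc by (simp add: c_def)
qed simp

lemma E0_term_le: "4 * (1 - cos (p $ i)) \<le> E0 p"
proof -
  have "1 - cos (p $ i) \<le> (\<Sum>i\<in>UNIV. 1 - cos (p $ i))"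
    by (rule member_le_sum) auto
  then show ?thesis by (simp add: E0_def)
qed

lemma E0_nonneg: "E0 p \<ge> 0"
  unfolding E0_def by (intro mult_nonneg_nonneg sum_nonneg) auto

lemma E0_dyadic_ge:
  assumes p: "p \<in> torus" and "p \<notin> dyadic_cube (Suc k)"
  shows "E0 p \<ge> 2 / 4 ^ k"
proof -
  obtain i where i: "\<bar>p $ i\<bar> > pi / 2 ^ Suc k" using assms by (auto simp: mem_dyadic_cube not_le)
  have "\<bar>p $ i\<bar> \<le> pi" using p unfolding mem_torus by (auto simp: abs_le_iff minus_le_iff)
  then have "cos \<bar>p $ i\<bar> \<le> cos (pi / 2 ^ Suc k)"
    using i by (intro cos_monotone_0_pi_le) auto
  then have "1 - cos (p $ i) \<ge> 2 / 4 ^ Suc k" using one_minus_cos_dyadic[of "Suc k"] by simp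
  \<comment> \<open>The factor 4 in \<open>E0\<close> absorbs the step from \<open>Suc k\<close>
    back to \<open>k\<close>.\<close>
  then show ?thesis using E0_term_le[of p i] by simp
qed

lemma torus_nonzero_dyadic:
  assumes p: "p \<in> torus" "p \<noteq> 0"
  shows "\<exists>k. p \<in> dyadic_cube k \<and> p \<notin> dyadic_cube (Suc k)"
proof -
  obtain i where i: "p $ i \<noteq> 0" using p by (auto simp: vec_eq_iff)
  obtain n where "pi / \<bar>p $ i\<bar> < 2 ^ n" using real_arch_pow[of 2 "pi / \<bar>p $ i\<bar>"] by auto
  then have "\<bar>p $ i\<bar> > pi / 2 ^ n" using i by (simp add: field_simps)
  then have n: "p \<notin> dyadic_cube n" by (auto simp: mem_dyadic_cube not_le)
  \<comment> \<open>Cube number zero is the whole torus, so the first cube that misses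
    \<open>p\<close> has a predecessor, and that one contains \<open>p\<close>.\<close>
  have "p \<in> dyadic_cube 0" using p unfolding mem_torus mem_dyadic_cube by (auto simp: abs_le_iff minus_le_iff)
  with n show ?thesis using ex_least_nat_less[of "\<lambda>n. p \<notin> dyadic_cube n" n] by auto
qed

lemma E0_pos: "p \<in> torus \<Longrightarrow> p \<noteq> 0 \<Longrightarrow> E0 p > 0"
  using torus_nonzero_dyadic[of p] E0_dyadic_ge[of p] by (meson divide_pos_pos less_le_trans zero_less_numeral zero_less_power)

lemma AE_E0_pos: "AE p in T3. E0 p > 0"
  using AE_T3_nonzero by (rule AE_mp) (auto intro!: AE_I2 E0_pos)

text \<open>The majorant sums over whole cubes instead of layers. The overlap is harmless, because
  the weights \<open>4 ^ k\<close> against volumes of order \<open>1 / 8 ^ k\<close> still form a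
  convergent geometric series; this is where dimension three enters.\<close>

lemma integrable_inverse_E0: "integrable T3 (\<lambda>p. 1 / E0 p)"
proof (rule integrableI_bounded)
  have le: "ennreal (norm (1 / E0 p)) \<le> (\<Sum>k. ennreal (4 ^ k) * indicator (dyadic_cube k) p)"
    if p: "p \<in> torus \<and> p \<noteq> 0" for p
  proof -
    obtain k where k: "p \<in> dyadic_cube k" "p \<notin> dyadic_cube (Suc k)"
      using torus_nonzero_dyadic p by blast
    have "E0 p \<ge> 2 / 4 ^ k" using E0_dyadic_ge k p by blast
    moreover have "E0 p > 0" using E0_pos p by blast
    ultimately have "1 / E0 p \<le> 4 ^ k" by (simp add: field_simps)
    then have "ennreal (norm (1 / E0 p)) \<le> ennreal (4 ^ k)"
      using E0_nonneg[of p] by (intro ennreal_leI) simp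
    also have "\<dots> = (\<Sum>j\<in>{k}. ennreal (4 ^ j) * indicator (dyadic_cube j) p)" using k by simp
    also have "\<dots> \<le> (\<Sum>k. ennreal (4 ^ k) * indicator (dyadic_cube k) p)"
      by (rule sum_le_suminf) auto
    finally show ?thesis .
  qed
  have "(\<integral>\<^sup>+p. ennreal (norm (1 / E0 p)) \<partial>T3)
      \<le> (\<integral>\<^sup>+p. (\<Sum>k. ennreal (4 ^ k) * indicator (dyadic_cube k) p) \<partial>T3)"
    by (rule nn_integral_mono_AE) (rule AE_mp[OF AE_T3_nonzero], rule AE_I2, use le in blast)
  also have "\<dots> = (\<Sum>k. (\<integral>\<^sup>+p. ennreal (4 ^ k) * indicator (dyadic_cube k) p \<partial>T3))"
    by (rule nn_integral_suminf) measurable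
  also have "\<dots> = (\<Sum>k. ennreal ((2 * pi) ^ 3 * (1 / 2) ^ k))"
  proof (intro suminf_cong)
    fix k
    have "(\<integral>\<^sup>+p. ennreal (4 ^ k) * indicator (dyadic_cube k) p \<partial>T3) = ennreal (4 ^ k) * ennreal ((2 * pi) ^ 3 / 8 ^ k)"
      by (simp add: nn_integral_cmult_indicator emeasure_dyadic_cube)
    also have "\<dots> = ennreal (4 ^ k * ((2 * pi) ^ 3 / 8 ^ k))" by (intro ennreal_mult[symmetric]) auto
    also have "(4 ^ k * ((2 * pi) ^ 3 / 8 ^ k)) = (2 * pi) ^ 3 * (1 / 2) ^ k"
      using power_mult_distrib[of 4 "2::real" k] by (simp add: power_one_over field_simps)
    finally show "(\<integral>\<^sup>+p. ennreal (4 ^ k) * indicator (dyadic_cube k) p \<partial>T3) = ennreal ((2 * pi) ^ 3 * (1 / 2) ^ k)" .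
  qed
  also have "\<dots> = ennreal (\<Sum>k. (2 * pi) ^ 3 * (1 / 2) ^ k)"
    by (intro suminf_ennreal2 summable_mult summable_geometric) auto
  also have "\<dots> < \<infinity>" by simp
  finally show "(\<integral>\<^sup>+p. ennreal (norm (1 / E0 p)) \<partial>T3) < \<infinity>" .
qed measurable

lemma E0_le_dyadic:
  assumes "p \<in> dyadic_cube k"
  shows "E0 p \<le> 6 * pi\<^sup>2 / 4 ^ k"
proof -
  have "1 - cos (p $ i) \<le> pi\<^sup>2 / 4 ^ k / 2" for i
  proof -
    have "1 - cos (p $ i) = 2 * (sin (p $ i / 2))\<^sup>2"
      using cos_double_sin[of "p $ i / 2"] by simp
    also have "(sin (p $ i / 2))\<^sup>2 = \<bar>sin (p $ i / 2)\<bar>\<^sup>2" by simp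
    also have "\<dots> \<le> \<bar>p $ i / 2\<bar>\<^sup>2" by (intro power_mono abs_sin_x_le_abs_x) auto
    also have "\<dots> = \<bar>p $ i\<bar>\<^sup>2 / 4" by (simp add: power_divide)
    also have "\<bar>p $ i\<bar>\<^sup>2 \<le> (pi / 2 ^ k)\<^sup>2"
      using assms by (intro power_mono) (auto simp: mem_dyadic_cube)
    also have "(pi / 2 ^ k)\<^sup>2 = pi\<^sup>2 / 4 ^ k"
      by (simp add: power_divide power_mult[symmetric] mult.commute[of k]) (simp add: power_mult)
    finally show ?thesis by simp
  qed
  then have "(\<Sum>i\<in>UNIV. 1 - cos (p $ i)) \<le> (\<Sum>i\<in>(UNIV::3 set). pi\<^sup>2 / 4 ^ k / 2)"
    by (intro sum_mono)
  then show ?thesis by (simp add: E0_def)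
qed

lemma not_integrable_inverse_E0_squared: "\<not> integrable T3 (\<lambda>p. (1 / E0 p)\<^sup>2)"
proof
  assume int: "integrable T3 (\<lambda>p. (1 / E0 p)\<^sup>2)"
  define I where "I = (LINT p|T3. (1 / E0 p)\<^sup>2)"
  define c where "c = (1 / (6 * pi\<^sup>2))\<^sup>2 * (2 * pi) ^ 3"
  have "2 ^ k * c \<le> I" for k :: nat
  proof -
    have "2 ^ k * c = (LINT p|T3. (4 ^ k / (6 * pi\<^sup>2))\<^sup>2 * indicator (dyadic_cube k) p)"
    proof -
      have "(2::real) ^ k * 8 ^ k = (4 ^ k)\<^sup>2"
        by (simp add: power2_eq_square power_mult_distrib[symmetric])
      then have "2 ^ k * c = (4 ^ k / (6 * pi\<^sup>2))\<^sup>2 * ((2 * pi) ^ 3 / 8 ^ k)"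
        by (simp add: c_def power_divide field_simps)
      moreover have "measure T3 (dyadic_cube k) = (2 * pi) ^ 3 / 8 ^ k"
        by (simp add: measure_def emeasure_dyadic_cube)
      moreover have "dyadic_cube k \<inter> torus = dyadic_cube k"
        using dyadic_cube_subset by auto
      ultimately show ?thesis by simp
    qed
    also have "\<dots> \<le> I"
      unfolding I_def
    proof (rule integral_mono_AE[OF _ int])
      show "integrable T3 (\<lambda>p. (4 ^ k / (6 * pi\<^sup>2))\<^sup>2 * indicat_real (dyadic_cube k) p)"
        by (intro integrable_mult_right T3.integrable_const_bound[of _ 1]) (auto simp: indicator_def)
      \<comment> \<open>At the origin the inequality fails, since there \<open>1 / E0 p\<close> is
        \<open>1 / 0 = 0\<close>; hence the restriction to \<open>E0 p > 0\<close>.\<close>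
      have "(4 ^ k / (6 * pi\<^sup>2))\<^sup>2 * indicat_real (dyadic_cube k) p \<le> (1 / E0 p)\<^sup>2" if "E0 p > 0" for p
      proof (cases "p \<in> dyadic_cube k")
        case True
        have "4 ^ k / (6 * pi\<^sup>2) \<le> 1 / E0 p"
          using E0_le_dyadic[OF True] that by (simp add: field_simps)
        then show ?thesis using True by (auto intro!: power_mono)
      qed simp
      then show "AE p in T3. (4 ^ k / (6 * pi\<^sup>2))\<^sup>2 * indicat_real (dyadic_cube k) p \<le> (1 / E0 p)\<^sup>2"
        using AE_E0_pos by (auto elim: AE_mp)
    qed
    finally show ?thesis .
  qed
  moreover have "c > 0" by (simp add: c_def)
  moreover obtain k where "I / c < 2 ^ k" using real_arch_pow[of 2 "I / c"] by auto
  ultimately show False by (metis mult.commute not_le pos_divide_less_eq)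
qed

section \<open>Averages of the free resolvent\<close>

text \<open>Since \<open>E0 - z = w - 4 csum\<close> for \<open>w = 12 - z\<close>, this is the free resolvent at the energy \<open>12 - w\<close>.\<close>

definition green :: "real \<Rightarrow> real^3 \<Rightarrow> real" where
  "green w p = 1 / (w - 4 * csum p)"

lemma green_measurable [measurable]: "green w \<in> borel_measurable T3"
  unfolding green_def by measurable

lemma green_nonneg: "w \<ge> 12 \<Longrightarrow> green w p \<ge> 0"
  using csum_bounds[of p] by (auto simp: green_def)

lemma AE_csum_less: "AE p in T3. csum p < 3"
  using AE_E0_pos by (simp add: E0_eq)

text \<open>Almost everywhere \<open>1 / E0\<close> is the largest of these functions, attained at
  \<open>w = 12\<close>, so the endpoint is included.\<close>

lemma integrable_green:
  assumes "w \<ge> 12"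
  shows "integrable T3 (green w)"
proof (rule Bochner_Integration.integrable_bound[OF integrable_inverse_E0])
  show "AE p in T3. norm (green w p) \<le> norm (1 / E0 p)"
    using AE_csum_less by (rule AE_mp) (use assms in \<open>auto intro!: AE_I2 simp: green_def E0_eq frac_le\<close>)
qed simp

lemma integrable_csum_power_mult:
  fixes f :: "real^3 \<Rightarrow> real"
  assumes "integrable T3 f"
  shows "integrable T3 (\<lambda>p. csum p ^ k * f p)"
proof (rule Bochner_Integration.integrable_bound)
  show "integrable T3 (\<lambda>p. 3 ^ k * f p)" using assms by simp
  have "\<bar>csum p\<bar> ^ k \<le> 3 ^ k" for p by (intro power_mono csum_bounds) auto
  then show "AE p in T3. norm (csum p ^ k * f p) \<le> norm (3 ^ k * f p)"
    by (auto intro!: AE_I2 mult_right_mono simp: norm_mult norm_power abs_mult power_abs)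
qed (use assms in measurable)

definition avg :: "(real^3 \<Rightarrow> real) \<Rightarrow> real" where
  "avg f = (LINT p|T3. f p) / (2 * pi) ^ 3"

lemma avg_const [simp]: "avg (\<lambda>p. c) = c"
  using measure_T3 by (simp add: avg_def)

lemma avg_add: "integrable T3 f \<Longrightarrow> integrable T3 g \<Longrightarrow> avg (\<lambda>p. f p + g p) = avg f + avg g"
  by (simp add: avg_def add_divide_distrib)

lemma avg_diff: "integrable T3 f \<Longrightarrow> integrable T3 g \<Longrightarrow> avg (\<lambda>p. f p - g p) = avg f - avg g"
  by (simp add: avg_def diff_divide_distrib)

lemma avg_mult [simp]: "avg (\<lambda>p. c * f p) = c * avg f"
  by (simp add: avg_def)

lemma avg_mono_AE:
  "integrable T3 f \<Longrightarrow> integrable T3 g \<Longrightarrow> AE p in T3. f p \<le> g p \<Longrightarrow> avg f \<le> avg g"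
  unfolding avg_def by (intro divide_right_mono integral_mono_AE) auto

lemma avg_cong_AE:
  "f \<in> borel_measurable T3 \<Longrightarrow> g \<in> borel_measurable T3 \<Longrightarrow> AE p in T3. f p = g p \<Longrightarrow> avg f = avg g"
  unfolding avg_def by (intro arg_cong2[where f = "(/)"] integral_cong_AE refl)

lemma integrable_T3_const [simp]: "integrable T3 (\<lambda>p. c :: 'b::{banach, second_countable_topology})"
  by (rule T3.integrable_const)

lemma integrable_csum [simp]: "integrable T3 csum"
  using integrable_csum_power_mult[of "\<lambda>p. 1" 1] by simp

lemma avg_csum [simp]: "avg csum = 0"
proof -
  have "integrable T3 (\<lambda>p. cos (p $ i))" for i
    by (rule T3.integrable_const_bound[of _ 1]) auto
  then show ?thesis by (simp add: avg_def csum_def[abs_def] integral_cos_T3)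
qed

definition gA :: "real \<Rightarrow> real" where "gA w = avg (green w)"
definition gB :: "real \<Rightarrow> real" where "gB w = avg (\<lambda>p. csum p * green w p)"

lemma AE_green_cancel:
  assumes "w \<ge> 12"
  shows "AE p in T3. (w - 4 * csum p) * green w p = 1"
  using AE_csum_less by (rule AE_mp) (use assms in \<open>auto intro!: AE_I2 simp: green_def\<close>)

lemma gA_bounds:
  assumes "w \<ge> 12"
  shows "gA w \<ge> 1 / (w + 12)" "gA w > 0"
proof -
  have "avg (\<lambda>p. 1 / (w + 12)) \<le> avg (green w)"
  proof (intro avg_mono_AE integrable_green assms)
    show "AE p in T3. 1 / (w + 12) \<le> green w p"
      using AE_csum_less
    proof (rule AE_mp, intro AE_I2 impI)
      fix p assume "csum p < 3"
      moreover have "csum p \<ge> -3" using csum_bounds[of p] by linarith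
      ultimately show "1 / (w + 12) \<le> green w p"
        unfolding green_def using assms by (intro frac_le) auto
    qed
  qed simp
  then show 1: "gA w \<ge> 1 / (w + 12)" by (simp only: avg_const gA_def)
  have "1 / (w + 12) > 0" using assms by simp
  with 1 show "gA w > 0" by linarith
qed

lemma gB_eq: assumes "w \<ge> 12" shows "4 * gB w = w * gA w - 1"
proof -
  note [simp] = integrable_green[OF assms] integrable_csum_power_mult[OF integrable_green[OF assms], of 1, simplified]
  have "1 = avg (\<lambda>p. w * green w p - 4 * (csum p * green w p))"
    by (subst avg_const[symmetric], rule avg_cong_AE)
       (use AE_green_cancel[OF assms] in \<open>auto simp: algebra_simps\<close>)
  also have "\<dots> = w * gA w - 4 * gB w" by (simp add: avg_diff gA_def gB_def)
  finally show ?thesis by simp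
qed

text \<open>Obtained by averaging \<open>csum * (w - 4 * csum) * green w = csum\<close>, whose right
  side has mean zero. It expresses \<open>gB\<close>, the average of a function of changing sign,
  through the average of a nonnegative one.\<close>

lemma gB_eq2: assumes "w \<ge> 12" shows "w * gB w = 4 * avg (\<lambda>p. (csum p)\<^sup>2 * green w p)"
proof -
  note [simp] = integrable_csum_power_mult[OF integrable_green[OF assms], of 1, simplified]
    integrable_csum_power_mult[OF integrable_green[OF assms], of 2, simplified]
  have "0 = avg csum" by simp
  also have "\<dots> = avg (\<lambda>p. w * (csum p * green w p) - 4 * ((csum p)\<^sup>2 * green w p))"
  proof (rule avg_cong_AE)
    show "AE p in T3. csum p = w * (csum p * green w p) - 4 * ((csum p)\<^sup>2 * green w p)"
      using AE_green_cancel[OF assms]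
    proof (rule AE_mp, intro AE_I2 impI)
      fix p assume "(w - 4 * csum p) * green w p = 1"
      then have "csum p * ((w - 4 * csum p) * green w p) = csum p" by simp
      then show "csum p = w * (csum p * green w p) - 4 * ((csum p)\<^sup>2 * green w p)"
        by (simp add: algebra_simps power2_eq_square)
    qed
  qed measurable
  also have "\<dots> = w * gB w - 4 * avg (\<lambda>p. (csum p)\<^sup>2 * green w p)"
    by (simp add: avg_diff gA_def gB_def)
  finally show ?thesis by simp
qed

lemma gB_pos: assumes "w \<ge> 12" shows "gB w > 0"
proof -
  note int = integrable_csum_power_mult[OF integrable_green[OF assms], of 2]
  have nn: "AE p in T3. 0 \<le> (csum p)\<^sup>2 * green w p" using green_nonneg[OF assms] by simp
  have "avg (\<lambda>p. (csum p)\<^sup>2 * green w p) \<ge> avg (\<lambda>p. 0)"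
    by (intro avg_mono_AE int nn) simp
  moreover have "avg (\<lambda>p. (csum p)\<^sup>2 * green w p) \<noteq> 0"
  proof
    assume "avg (\<lambda>p. (csum p)\<^sup>2 * green w p) = 0"
    then have "(LINT p|T3. (csum p)\<^sup>2 * green w p) = 0" by (simp add: avg_def)
    then have "AE p in T3. (csum p)\<^sup>2 * green w p = 0"
      by (subst (asm) integral_nonneg_eq_0_iff_AE[OF int nn])
    then have 0: "AE p in T3. csum p = 0"
      using AE_csum_less by eventually_elim (use assms in \<open>auto simp: green_def\<close>)
    \<comment> \<open>Strict positivity only requires that \<open>csum\<close> is not null; at the
      origin it equals 3.\<close>
    have "\<exists>p\<in>{p. csum p > 0}. csum p = 0"
      by (rule AE_T3_ex[OF 0, of _ 0]) (auto intro!: open_Collect_less continuous_csum continuous_intros simp: csum_def)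
    then show False by auto
  qed
  ultimately have "w * gB w > 0" using gB_eq2[OF assms] by simp
  then show ?thesis using assms by (simp add: zero_less_mult_iff)
qed

lemma gB_le: assumes "w \<ge> 12" shows "w * gB w \<le> 36 * gA w"
proof -
  have "avg (\<lambda>p. (csum p)\<^sup>2 * green w p) \<le> avg (\<lambda>p. 9 * green w p)"
  proof (intro avg_mono_AE integrable_csum_power_mult integrable_mult_right integrable_green assms AE_I2 mult_right_mono green_nonneg)
    show "(csum p)\<^sup>2 \<le> 9" for p using power_mono[OF csum_bounds[of p], of 2] by simp
  qed
  then show ?thesis using gB_eq2[OF assms] by (simp add: gA_def)
qed

section \<open>Growth, monotonicity and continuity of \<open>mfun\<close>\<close>

definition mfun :: "real \<Rightarrow> real" where "mfun w = 6 * gA w / gB w"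

text \<open>Supplies the far endpoint of the intermediate value argument for the positive root,
  whatever the couplings are.\<close>

lemma mfun_ge: assumes "w \<ge> 12" shows "mfun w \<ge> w / 6"
  using gB_le[OF assms] gB_pos[OF assms] by (simp add: mfun_def field_simps)

text \<open>
  Integrating a square against the product of the two Green functions is the Cauchy-Schwarz
  argument for the monotonicity of \<open>w - 1 / gA w\<close>, in integrated form.
\<close>

lemma gA_diff_ge:
  assumes w: "12 \<le> w1" "w1 < w2"
  shows "(w2 - w1) * gA w1 * gA w2 \<le> gA w1 - gA w2"
proof -
  define d where "d = w2 - w1"
  define A1 where "A1 = gA w1"
  define A2 where "A2 = gA w2"
  have d: "d > 0" using w by (simp add: d_def)
  have A: "A1 > 0" "A2 > 0" using gA_bounds w by (auto simp: A1_def A2_def)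
  note int [simp] = integrable_green[OF w(1)] integrable_green[of w2]
  have g: "AE p in T3. (w1 - 4 * csum p) * green w1 p = 1 \<and> (w2 - 4 * csum p) * green w2 p = 1"
    using AE_green_cancel[OF w(1)] AE_green_cancel[of w2] w by auto
  have "avg (\<lambda>p. 0) \<le> avg (\<lambda>p. (green w1 p - green w2 p) - 2 * d * A2 * green w1 p + d * A2\<^sup>2 * (1 + d * green w1 p))"
  proof (rule avg_mono_AE)
    show "AE p in T3. 0 \<le> (green w1 p - green w2 p) - 2 * d * A2 * green w1 p + d * A2\<^sup>2 * (1 + d * green w1 p)"
      using g
    proof (rule AE_mp, intro AE_I2 impI)
      fix p assume *: "(w1 - 4 * csum p) * green w1 p = 1 \<and> (w2 - 4 * csum p) * green w2 p = 1"
      define X where "X = w2 - 4 * csum p"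
      have x1: "X * green w1 p = 1 + d * green w1 p" using * by (simp add: X_def d_def algebra_simps)
      have x2: "X * green w2 p = 1" using * by (simp add: X_def)
      have x12: "d * (green w1 p * green w2 p) = green w1 p - green w2 p"
      proof -
        have "(X * green w1 p) * green w2 p = (1 + d * green w1 p) * green w2 p" by (simp only: x1)
        then have "(X * green w2 p) * green w1 p = (1 + d * green w1 p) * green w2 p" by (simp only: mult_ac)
        then show ?thesis by (simp only: x2) (simp add: algebra_simps)
      qed
      \<comment> \<open>With the constant \<open>A2\<close> inside the square, the average of this
        expression factors as \<open>(A1 - A2 - d * A1 * A2) * (1 - d * A2)\<close>, so only the
        sign of the second factor remains to be found.\<close>
      have "0 \<le> d * (green w1 p * green w2 p) * (1 - A2 * X)\<^sup>2"
        using d green_nonneg[of w1 p] green_nonneg[of w2 p] w by (intro mult_nonneg_nonneg) auto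
      also have "\<dots> = d * (green w1 p * green w2 p) - 2 * d * A2 * green w1 p * (X * green w2 p) + d * A2\<^sup>2 * (X * green w1 p) * (X * green w2 p)"
        by (simp add: power2_eq_square algebra_simps)
      finally show "0 \<le> (green w1 p - green w2 p) - 2 * d * A2 * green w1 p + d * A2\<^sup>2 * (1 + d * green w1 p)"
        by (simp only: x1 x2 x12 mult_1_right)
    qed
  qed (use w in simp_all)
  also have "\<dots> = (A1 - A2) - 2 * d * A2 * A1 + d * A2\<^sup>2 * (1 + d * A1)"
    using w by (simp add: avg_add avg_diff A1_def A2_def gA_def)
  also have "\<dots> = (A1 - A2 - d * A1 * A2) * (1 - d * A2)"
    by (simp add: algebra_simps power2_eq_square)
  finally have "0 \<le> (A1 - A2 - d * A1 * A2) * (1 - d * A2)" by simp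
  \<comment> \<open>By \<open>gB_eq\<close> this quantity is the average of
    \<open>(w1 - 4 * csum) * green w2\<close>, where the first factor is nonnegative and the second
    is at least \<open>1 / (w2 + 12)\<close>.\<close>
  moreover have "1 - d * A2 > 0"
  proof -
    have "w1 * A2 \<ge> 4 * gB w2 + w1 / (w2 + 12)"
    proof -
      have "avg (\<lambda>p. (1 / (w2 + 12)) * (w1 - 4 * csum p)) \<le> avg (\<lambda>p. w1 * green w2 p - 4 * (csum p * green w2 p))"
      proof (rule avg_mono_AE)
        show "AE p in T3. (1 / (w2 + 12)) * (w1 - 4 * csum p) \<le> w1 * green w2 p - 4 * (csum p * green w2 p)"
        proof (intro AE_I2)
          fix p
          have "1 / (w2 + 12) \<le> green w2 p"
            unfolding green_def using csum_bounds[of p] w by (intro frac_le) (auto simp: abs_le_iff)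
          moreover have "w1 - 4 * csum p \<ge> 0" using csum_bounds[of p] w by auto
          ultimately have "(1 / (w2 + 12)) * (w1 - 4 * csum p) \<le> green w2 p * (w1 - 4 * csum p)"
            by (rule mult_right_mono)
          then show "(1 / (w2 + 12)) * (w1 - 4 * csum p) \<le> w1 * green w2 p - 4 * (csum p * green w2 p)"
            by (simp add: algebra_simps)
        qed
      qed (use w integrable_csum_power_mult[of "green w2" 1] in simp_all)
      moreover have "avg (\<lambda>p. (1 / (w2 + 12)) * (w1 - 4 * csum p)) = w1 / (w2 + 12)"
        by (simp only: avg_mult) (simp add: avg_diff)
      moreover have "avg (\<lambda>p. w1 * green w2 p - 4 * (csum p * green w2 p)) = w1 * A2 - 4 * gB w2"
        using w integrable_csum_power_mult[of "green w2" 1] by (simp add: avg_diff A2_def gA_def gB_def)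
      ultimately show ?thesis by simp
    qed
    moreover have "w1 / (w2 + 12) > 0" using w by simp
    moreover have "4 * gB w2 = w2 * A2 - 1" using gB_eq[of w2] w by (simp add: A2_def)
    ultimately show ?thesis by (simp add: d_def algebra_simps)
  qed
  ultimately have "0 \<le> A1 - A2 - d * A1 * A2" by (simp add: zero_le_mult_iff)
  then show ?thesis by (simp add: d_def A1_def A2_def)
qed

text \<open>By \<open>gB_eq\<close>, \<open>mfun w\<close> equals
  \<open>24 / (w - 1 / gA w)\<close>, and \<open>gA_diff_ge\<close> says that this positive
  denominator does not increase.\<close>

lemma mfun_mono:
  assumes w: "12 \<le> w1" "w1 \<le> w2"
  shows "mfun w1 \<le> mfun w2"
proof (cases "w1 = w2")
  case False
  then have w': "w1 < w2" using w by simp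
  have A: "gA w1 > 0" "gA w2 > 0" and B: "gB w1 > 0" "gB w2 > 0"
    using gA_bounds gB_pos w by auto
  have "gA w1 * (4 * gB w2) \<le> gA w2 * (4 * gB w1)"
  proof -
    have "gA w1 * (w2 * gA w2 - 1) \<le> gA w2 * (w1 * gA w1 - 1)"
      using gA_diff_ge[OF w(1) w'] by (simp add: algebra_simps)
    then show ?thesis using w by (simp add: gB_eq)
  qed
  then show ?thesis using B by (simp add: mfun_def field_simps)
qed simp

text \<open>The bound \<open>1 / E0\<close> dominates uniformly in \<open>w\<close>, so continuity
  reaches the endpoint 12, from which the intermediate value arguments start.\<close>

lemma continuous_gA: "continuous_on {12..} gA"
proof (rule continuous_on_sequentiallyI)
  fix u :: "nat \<Rightarrow> real" and a assume u: "\<forall>n. u n \<in> {12..}" and a: "a \<in> {12..}" and lim: "u \<longlonglongrightarrow> a"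
  have "(\<lambda>n. LINT p|T3. green (u n) p) \<longlonglongrightarrow> (LINT p|T3. green a p)"
  proof (rule integral_dominated_convergence)
    show "integrable T3 (\<lambda>p. 1 / E0 p)" by (rule integrable_inverse_E0)
    show "AE p in T3. (\<lambda>n. green (u n) p) \<longlonglongrightarrow> green a p"
      using AE_csum_less
    proof (rule AE_mp, intro AE_I2 impI)
      fix p assume "csum p < 3"
      then show "(\<lambda>n. green (u n) p) \<longlonglongrightarrow> green a p"
        unfolding green_def using a by (intro tendsto_intros lim) auto
    qed
    show "AE p in T3. norm (green (u n) p) \<le> 1 / E0 p" for n
      using AE_csum_less
    proof (rule AE_mp, intro AE_I2 impI)
      fix p assume "csum p < 3"
      moreover have "u n \<ge> 12" using u by auto
      ultimately show "norm (green (u n) p) \<le> 1 / E0 p"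
        by (simp add: green_def E0_eq frac_le)
    qed
  qed measurable
  then show "(\<lambda>n. gA (u n)) \<longlonglongrightarrow> gA a"
    unfolding gA_def avg_def by (intro tendsto_divide tendsto_const) auto
qed

lemma continuous_mfun: "continuous_on {12..} mfun"
proof -
  have c1: "continuous_on {12..} (\<lambda>w. 24 * gA w / (w * gA w - 1))"
    by (intro continuous_intros continuous_gA) (use gB_eq gB_pos in fastforce)
  have c2: "mfun w = 24 * gA w / (w * gA w - 1)" if "w \<in> {12..}" for w
    using that gB_pos[of w] by (simp add: mfun_def gB_eq[symmetric])
  show ?thesis by (rule continuous_on_eq[OF c1 c2[symmetric]])
qed

lemma a11_eq: "a11 = gA 12"
  by (simp add: a11_def gA_def avg_def green_def[abs_def] E0_eq power_mult_distrib)

lemma mu0_eq: "\<mu>\<^sub>0 = mfun 12"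
  using gB_eq[of 12, symmetric] by (simp add: \<mu>\<^sub>0_def mfun_def a11_eq)

section \<open>The eigenvalue equation\<close>

definition roots :: "real \<Rightarrow> real \<Rightarrow> real set" where
  "roots \<mu>\<^sub>1 \<mu>\<^sub>2 = {w. w > 12 \<and> (w + \<mu>\<^sub>1) * (mfun w + \<mu>\<^sub>2) = 24}"

definition pos_roots :: "real \<Rightarrow> real \<Rightarrow> real set" where
  "pos_roots \<mu>\<^sub>1 \<mu>\<^sub>2 = {w \<in> roots \<mu>\<^sub>1 \<mu>\<^sub>2. w + \<mu>\<^sub>1 > 0 \<and> mfun w + \<mu>\<^sub>2 > 0}"

definition neg_roots :: "real \<Rightarrow> real \<Rightarrow> real set" where
  "neg_roots \<mu>\<^sub>1 \<mu>\<^sub>2 = {w \<in> roots \<mu>\<^sub>1 \<mu>\<^sub>2. w + \<mu>\<^sub>1 < 0 \<and> mfun w + \<mu>\<^sub>2 < 0}"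

lemma roots_split: "roots \<mu>\<^sub>1 \<mu>\<^sub>2 = pos_roots \<mu>\<^sub>1 \<mu>\<^sub>2 \<union> neg_roots \<mu>\<^sub>1 \<mu>\<^sub>2"
proof -
  have "(a > 0 \<and> b > 0) \<or> (a < 0 \<and> b < 0)" if "a * b = (24::real)" for a b
    using that zero_less_mult_iff[of a b] by simp
  then show ?thesis unfolding pos_roots_def neg_roots_def roots_def by blast
qed

lemma pos_neg_disjoint: "pos_roots \<mu>\<^sub>1 \<mu>\<^sub>2 \<inter> neg_roots \<mu>\<^sub>1 \<mu>\<^sub>2 = {}"
  by (auto simp: pos_roots_def neg_roots_def)

text \<open>Weak monotonicity of \<open>mfun\<close> is enough: strictness comes from the factor
  \<open>w + \<mu>\<^sub>1\<close>.\<close>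

lemma pos_prod_strict_mono:
  assumes "12 \<le> w" "w < w'" "w + \<mu>\<^sub>1 > 0" "mfun w + \<mu>\<^sub>2 > 0"
  shows "(w + \<mu>\<^sub>1) * (mfun w + \<mu>\<^sub>2) < (w' + \<mu>\<^sub>1) * (mfun w' + \<mu>\<^sub>2)"
  using assms mfun_mono[of w w'] by (intro mult_less_le_imp_less) auto

lemma neg_prod_strict_mono:
  assumes "12 \<le> w" "w < w'" "w' + \<mu>\<^sub>1 < 0" "mfun w' + \<mu>\<^sub>2 < 0"
  shows "(w' + \<mu>\<^sub>1) * (mfun w' + \<mu>\<^sub>2) < (w + \<mu>\<^sub>1) * (mfun w + \<mu>\<^sub>2)"
proof -
  have "(- (w' + \<mu>\<^sub>1)) * (- (mfun w' + \<mu>\<^sub>2)) < (- (w + \<mu>\<^sub>1)) * (- (mfun w + \<mu>\<^sub>2))"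
    using assms mfun_mono[of w w'] by (intro mult_less_le_imp_less) auto
  then show ?thesis by (simp only: minus_mult_minus)
qed

lemma pos_roots_unique: "w \<in> pos_roots \<mu>\<^sub>1 \<mu>\<^sub>2 \<Longrightarrow> w' \<in> pos_roots \<mu>\<^sub>1 \<mu>\<^sub>2 \<Longrightarrow> w = w'"
  using pos_prod_strict_mono[of w w' \<mu>\<^sub>1 \<mu>\<^sub>2] pos_prod_strict_mono[of w' w \<mu>\<^sub>1 \<mu>\<^sub>2]
  by (cases w w' rule: linorder_cases) (auto simp: pos_roots_def roots_def)

lemma neg_roots_unique: "w \<in> neg_roots \<mu>\<^sub>1 \<mu>\<^sub>2 \<Longrightarrow> w' \<in> neg_roots \<mu>\<^sub>1 \<mu>\<^sub>2 \<Longrightarrow> w = w'"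
  using neg_prod_strict_mono[of w w' \<mu>\<^sub>1 \<mu>\<^sub>2] neg_prod_strict_mono[of w' w \<mu>\<^sub>1 \<mu>\<^sub>2]
  by (cases w w' rule: linorder_cases) (auto simp: neg_roots_def roots_def)

text \<open>Both factors are positive at 12, so the product starts at 24 or above and increases
  strictly. The case of equality, which is the threshold curve, is included.\<close>

lemma pos_roots_empty:
  assumes "12 + \<mu>\<^sub>1 > 0" "(12 + \<mu>\<^sub>1) * (mfun 12 + \<mu>\<^sub>2) \<ge> 24"
  shows "pos_roots \<mu>\<^sub>1 \<mu>\<^sub>2 = {}"
proof -
  have "mfun 12 + \<mu>\<^sub>2 > 0" using assms zero_less_mult_iff[of "12 + \<mu>\<^sub>1"] by (smt (verit))
  then show ?thesis
    using assms pos_prod_strict_mono[of 12 _ \<mu>\<^sub>1 \<mu>\<^sub>2] by (force simp: pos_roots_def roots_def)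
qed

text \<open>At a negative root both factors are negative, and going back to 12 moves the first
  strictly away from zero and the second no closer to it. The product at 12 would then exceed 24,
  with \<open>12 + \<mu>\<^sub>1\<close> negative.\<close>

lemma neg_roots_empty:
  assumes "12 + \<mu>\<^sub>1 \<ge> 0 \<or> (12 + \<mu>\<^sub>1) * (mfun 12 + \<mu>\<^sub>2) \<le> 24"
  shows "neg_roots \<mu>\<^sub>1 \<mu>\<^sub>2 = {}"
  using assms neg_prod_strict_mono[of 12 _ \<mu>\<^sub>1 \<mu>\<^sub>2] by (force simp: neg_roots_def roots_def)

text \<open>The truncations at zero keep the intermediate value theorem on the positive branch: a
  point with \<open>P w = 24\<close> has both factors positive, and a large product of two negative
  factors at 12 does not disturb the starting value.\<close>

lemma card_pos_roots:
  assumes "12 + \<mu>\<^sub>1 \<le> 0 \<or> (12 + \<mu>\<^sub>1) * (mfun 12 + \<mu>\<^sub>2) < 24"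
  shows "card (pos_roots \<mu>\<^sub>1 \<mu>\<^sub>2) = 1"
proof -
  define P where "P = (\<lambda>w. max 0 (w + \<mu>\<^sub>1) * max 0 (mfun w + \<mu>\<^sub>2))"
  \<comment> \<open>Large enough that the factors at \<open>b\<close> are at least 4 and 6, the
    second by \<open>mfun_ge\<close>.\<close>
  define b where "b = 36 + \<bar>\<mu>\<^sub>1\<bar> + 6 * \<bar>\<mu>\<^sub>2\<bar>"
  have b: "b \<ge> 12" by (simp add: b_def)
  have P12: "P 12 < 24"
    using assms unfolding P_def max_def by (auto simp: not_le)
  have "b / 6 \<ge> 6 - \<mu>\<^sub>2" by (simp add: b_def)
  then have "mfun b + \<mu>\<^sub>2 \<ge> 6" using mfun_ge[OF b] by linarith
  moreover have "b + \<mu>\<^sub>1 \<ge> 4" unfolding b_def by linarith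
  ultimately have "4 * 6 \<le> P b" unfolding P_def by (intro mult_mono) auto
  then have Pb: "P b \<ge> 24" by simp
  have "continuous_on {12..b} P" unfolding P_def
    by (intro continuous_intros continuous_on_subset[OF continuous_mfun]) auto
  then obtain w where w: "12 \<le> w" "P w = 24" using IVT'[of P 12 24 b] P12 Pb b by auto
  then have "w \<noteq> 12" using P12 by auto
  moreover have "w + \<mu>\<^sub>1 > 0" by (rule ccontr) (use w in \<open>simp add: P_def max_absorb1 not_less\<close>)
  moreover have "mfun w + \<mu>\<^sub>2 > 0" by (rule ccontr) (use w in \<open>simp add: P_def max_absorb1 not_less\<close>)
  ultimately have "w \<in> pos_roots \<mu>\<^sub>1 \<mu>\<^sub>2"
    using w by (simp add: pos_roots_def roots_def P_def)
  then have "pos_roots \<mu>\<^sub>1 \<mu>\<^sub>2 = {w}" using pos_roots_unique by blast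
  then show ?thesis by simp
qed

lemma card_neg_roots:
  assumes "12 + \<mu>\<^sub>1 < 0" "(12 + \<mu>\<^sub>1) * (mfun 12 + \<mu>\<^sub>2) > 24"
  shows "card (neg_roots \<mu>\<^sub>1 \<mu>\<^sub>2) = 1"
proof -
  define P where "P = (\<lambda>w. max 0 (- (w + \<mu>\<^sub>1)) * max 0 (- (mfun w + \<mu>\<^sub>2)))"
  \<comment> \<open>At \<open>b\<close> the first factor is no longer negative, so the truncated
    product vanishes.\<close>
  define b where "b = 12 + \<bar>\<mu>\<^sub>1\<bar>"
  have b: "b \<ge> 12" by (simp add: b_def)
  have "mfun 12 + \<mu>\<^sub>2 < 0" using assms zero_less_mult_iff[of "12 + \<mu>\<^sub>1"] by (smt (verit))
  then have "P 12 = (12 + \<mu>\<^sub>1) * (mfun 12 + \<mu>\<^sub>2)"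
    using assms by (simp add: P_def max_absorb2 algebra_simps)
  then have P12: "P 12 > 24" using assms by simp
  have "b + \<mu>\<^sub>1 \<ge> 0" unfolding b_def by linarith
  then have Pb: "P b \<le> 24" by (simp add: P_def)
  have "continuous_on {12..b} P" unfolding P_def
    by (intro continuous_intros continuous_on_subset[OF continuous_mfun]) auto
  then obtain w where w: "12 \<le> w" "P w = 24" using IVT2'[of P b 24 12] P12 Pb b by auto
  then have "w \<noteq> 12" using P12 by auto
  moreover have neg: "w + \<mu>\<^sub>1 < 0" "mfun w + \<mu>\<^sub>2 < 0"
    by (rule ccontr, use w in \<open>simp add: P_def max_absorb1 not_less\<close>)+
  moreover from neg have "P w = (w + \<mu>\<^sub>1) * (mfun w + \<mu>\<^sub>2)" by (simp add: P_def max_absorb2 algebra_simps)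
  ultimately have "w \<in> neg_roots \<mu>\<^sub>1 \<mu>\<^sub>2"
    using w by (simp add: neg_roots_def roots_def)
  then have "neg_roots \<mu>\<^sub>1 \<mu>\<^sub>2 = {w}" using neg_roots_unique by blast
  then show ?thesis by simp
qed

lemma finite_roots: "finite (roots \<mu>\<^sub>1 \<mu>\<^sub>2)"
proof -
  have "finite A" if "\<And>w w'. w \<in> A \<Longrightarrow> w' \<in> A \<Longrightarrow> w = w'" for A :: "real set"
    using that by (metis finite.emptyI finite.insertI finite_subset insertCI subsetI)
  then show ?thesis unfolding roots_split using pos_roots_unique neg_roots_unique
    by (metis finite_UnI)
qed

lemma card_roots: "card (roots \<mu>\<^sub>1 \<mu>\<^sub>2) = card (pos_roots \<mu>\<^sub>1 \<mu>\<^sub>2) + card (neg_roots \<mu>\<^sub>1 \<mu>\<^sub>2)"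
  using finite_roots[of \<mu>\<^sub>1 \<mu>\<^sub>2] unfolding roots_split by (simp add: card_Un_disjoint pos_neg_disjoint)

text \<open>The defining inequality is multiplied by \<open>12 + \<mu>\<^sub>1\<close>, which
  reverses it in the third and fourth claims.\<close>

lemma threshold_curve:
  shows "\<mu>\<^sub>1 > -12 \<Longrightarrow> \<mu>\<^sub>2 > \<mu>\<^sub>2_minus \<mu>\<^sub>1 \<longleftrightarrow> (12 + \<mu>\<^sub>1) * (mfun 12 + \<mu>\<^sub>2) > 24"
    and "\<mu>\<^sub>1 > -12 \<Longrightarrow> \<mu>\<^sub>2 < \<mu>\<^sub>2_minus \<mu>\<^sub>1 \<longleftrightarrow> (12 + \<mu>\<^sub>1) * (mfun 12 + \<mu>\<^sub>2) < 24"
    and "\<mu>\<^sub>1 < -12 \<Longrightarrow> \<mu>\<^sub>2 > \<mu>\<^sub>2_minus \<mu>\<^sub>1 \<longleftrightarrow> (12 + \<mu>\<^sub>1) * (mfun 12 + \<mu>\<^sub>2) < 24"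
    and "\<mu>\<^sub>1 < -12 \<Longrightarrow> \<mu>\<^sub>2 < \<mu>\<^sub>2_minus \<mu>\<^sub>1 \<longleftrightarrow> (12 + \<mu>\<^sub>1) * (mfun 12 + \<mu>\<^sub>2) > 24"
    and "\<mu>\<^sub>1 \<noteq> -12 \<Longrightarrow> \<mu>\<^sub>2 = \<mu>\<^sub>2_minus \<mu>\<^sub>1 \<longleftrightarrow> (12 + \<mu>\<^sub>1) * (mfun 12 + \<mu>\<^sub>2) = 24"
  unfolding \<mu>\<^sub>2_minus_def mu0_eq by (auto simp: field_simps)

text \<open>The line \<open>\<mu>\<^sub>1 = - 12\<close>, where the curve has its pole, fits the
  middle region: the product at 12 is zero there, so the positive root exists, while
  \<open>w + \<mu>\<^sub>1\<close> is positive for \<open>w > 12\<close> and excludes a negative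
  one.\<close>

lemma card_roots_A:
  assumes "(\<mu>\<^sub>1, \<mu>\<^sub>2) \<in> A_minus k"
  shows "card (roots \<mu>\<^sub>1 \<mu>\<^sub>2) = k"
proof -
  note [simp] = card_roots
  consider "k = 0" | "k = 1" | "k = 2" using assms by (cases k rule: A_minus.cases) auto
  then show ?thesis
  proof cases
    case 1
    then have "\<mu>\<^sub>1 > -12" "(12 + \<mu>\<^sub>1) * (mfun 12 + \<mu>\<^sub>2) > 24"
      using assms threshold_curve(1) by auto
    then show ?thesis using 1 pos_roots_empty neg_roots_empty by simp
  next
    case 2
    then consider "\<mu>\<^sub>1 > -12" "(12 + \<mu>\<^sub>1) * (mfun 12 + \<mu>\<^sub>2) < 24" | "\<mu>\<^sub>1 < -12" "(12 + \<mu>\<^sub>1) * (mfun 12 + \<mu>\<^sub>2) < 24" | "\<mu>\<^sub>1 = -12"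
      using assms threshold_curve(2,3) by auto
    then show ?thesis using 2 card_pos_roots neg_roots_empty by cases auto
  next
    case 3
    then have "\<mu>\<^sub>1 < -12" "(12 + \<mu>\<^sub>1) * (mfun 12 + \<mu>\<^sub>2) > 24"
      using assms threshold_curve(4) by (auto simp: numeral_2_eq_2)
    then show ?thesis using 3 card_pos_roots card_neg_roots by simp
  qed
qed

text \<open>On the curve one solution sits exactly at \<open>w = 12\<close>, which the strict
  inequality in \<open>roots\<close> leaves out. The count is therefore that of the side on which
  this root has not yet emerged.\<close>

lemma card_roots_tau:
  assumes "(\<mu>\<^sub>1, \<mu>\<^sub>2) \<in> \<tau>_minus k"
  shows "card (roots \<mu>\<^sub>1 \<mu>\<^sub>2) = k" and "(12 + \<mu>\<^sub>1) * (mfun 12 + \<mu>\<^sub>2) = 24"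
proof -
  note [simp] = card_roots
  consider "k = 0" "\<mu>\<^sub>1 > -12" "\<mu>\<^sub>2 = \<mu>\<^sub>2_minus \<mu>\<^sub>1" | "k = 1" "\<mu>\<^sub>1 < -12" "\<mu>\<^sub>2 = \<mu>\<^sub>2_minus \<mu>\<^sub>1"
    using assms by (cases k rule: \<tau>_minus.cases) auto
  then have "card (roots \<mu>\<^sub>1 \<mu>\<^sub>2) = k \<and> (12 + \<mu>\<^sub>1) * (mfun 12 + \<mu>\<^sub>2) = 24"
  proof cases
    case 1
    then have "(12 + \<mu>\<^sub>1) * (mfun 12 + \<mu>\<^sub>2) = 24" using threshold_curve(5)[of \<mu>\<^sub>1 \<mu>\<^sub>2] by simp
    then show ?thesis using 1 pos_roots_empty neg_roots_empty by simp
  next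
    case 2
    then have "(12 + \<mu>\<^sub>1) * (mfun 12 + \<mu>\<^sub>2) = 24" using threshold_curve(5)[of \<mu>\<^sub>1 \<mu>\<^sub>2] by simp
    then show ?thesis using 2 card_pos_roots neg_roots_empty by simp
  qed
  then show "card (roots \<mu>\<^sub>1 \<mu>\<^sub>2) = k" "(12 + \<mu>\<^sub>1) * (mfun 12 + \<mu>\<^sub>2) = 24" by auto
qed

text \<open>The determinant of the two-by-two system that a solution imposes on its averages against
  \<open>1\<close> and \<open>csum\<close>. The terms with \<open>gA w * gB w\<close> cancel by
  \<open>gB_eq\<close>, which leaves this form.\<close>

definition Delta :: "real \<Rightarrow> real \<Rightarrow> real \<Rightarrow> real" where
  "Delta \<mu>\<^sub>1 \<mu>\<^sub>2 w = 1 + \<mu>\<^sub>1 * gA w + \<mu>\<^sub>2 / 6 * gB w * (w + \<mu>\<^sub>1)"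

text \<open>Multiplied by \<open>6 / gB w\<close>, the constant term 1 becomes
  \<open>6 / gB w = w * mfun w - 24\<close> by \<open>gB_eq\<close>. This completes the product and
  is the origin of 24.\<close>

lemma Delta_eq_0_iff:
  assumes "w \<ge> 12"
  shows "Delta \<mu>\<^sub>1 \<mu>\<^sub>2 w = 0 \<longleftrightarrow> (w + \<mu>\<^sub>1) * (mfun w + \<mu>\<^sub>2) = 24"
proof -
  have B: "gB w > 0" using gB_pos assms by blast
  have "6 / gB w * Delta \<mu>\<^sub>1 \<mu>\<^sub>2 w = (w + \<mu>\<^sub>1) * (mfun w + \<mu>\<^sub>2) - 6 / gB w * (w * gA w - 1)"
    using B by (simp add: Delta_def mfun_def field_simps)
  also have "\<dots> = (w + \<mu>\<^sub>1) * (mfun w + \<mu>\<^sub>2) - 24"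
    using B gB_eq[OF assms, symmetric] by simp
  finally have eq: "6 / gB w * Delta \<mu>\<^sub>1 \<mu>\<^sub>2 w = (w + \<mu>\<^sub>1) * (mfun w + \<mu>\<^sub>2) - 24" .
  have "6 / gB w \<noteq> 0" using B by simp
  then have "Delta \<mu>\<^sub>1 \<mu>\<^sub>2 w = 0 \<longleftrightarrow> 6 / gB w * Delta \<mu>\<^sub>1 \<mu>\<^sub>2 w = 0" by simp
  then show ?thesis unfolding eq by simp
qed

section \<open>The resolvent equation\<close>

definition cavg :: "torus_fun \<Rightarrow> complex" where
  "cavg f = (LINT p|T3. f p) / of_real ((2 * pi) ^ 3)"

lemma cavg_const [simp]: "cavg (\<lambda>p. c) = c"
  using measure_T3 by (simp add: cavg_def scaleR_conv_of_real)

lemma cavg_of_real [simp]: "cavg (\<lambda>p. of_real (f p)) = of_real (avg f)"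
  by (simp add: cavg_def avg_def)

lemma cavg_mult [simp]: "cavg (\<lambda>p. c * f p) = c * cavg f"
  by (simp add: cavg_def)

lemma cavg_mult_right [simp]: "cavg (\<lambda>p. f p * c) = cavg f * c"
  by (simp add: cavg_def)

lemma cavg_add: "integrable T3 f \<Longrightarrow> integrable T3 g \<Longrightarrow> cavg (\<lambda>p. f p + g p) = cavg f + cavg g"
  by (simp add: cavg_def add_divide_distrib)

lemma cavg_cong_AE:
  "f \<in> borel_measurable T3 \<Longrightarrow> g \<in> borel_measurable T3 \<Longrightarrow> AE p in T3. f p = g p \<Longrightarrow> cavg f = cavg g"
  unfolding cavg_def by (intro arg_cong2[where f = "(/)"] integral_cong_AE refl)

lemma norm_cavg_le: "norm (cavg f) \<le> avg (\<lambda>p. norm (f p))"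
proof -
  have "norm (cavg f) = norm (LINT p|T3. f p) / (2 * pi) ^ 3"
    unfolding cavg_def norm_divide norm_of_real by simp
  then show ?thesis unfolding avg_def by (simp only:) (intro divide_right_mono integral_norm_bound, simp)
qed

lemma csum_uminus: "csum (- p) = csum p"
  by (simp add: csum_def)

lemma csum_permute: "bij s \<Longrightarrow> csum (\<chi> i. p $ s i) = csum p"
  unfolding csum_def using sum.reindex_bij_betw[of s UNIV UNIV "\<lambda>i. cos (p $ i)"] by simp

lemma Lr_even_sym_measurable: "f \<in> Lr_even_sym r \<Longrightarrow> f \<in> borel_measurable T3"
  by (simp add: Lr_even_sym_def Lr_even_def)

lemma Lr_even_sym_integrable_power: "f \<in> Lr_even_sym r \<Longrightarrow> integrable T3 (\<lambda>p. norm (f p) ^ r)"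
  by (simp add: Lr_even_sym_def Lr_even_def)

lemma Lr_even_sym_integrable:
  assumes "f \<in> Lr_even_sym r" "r \<ge> 1"
  shows "integrable T3 f"
proof (rule Bochner_Integration.integrable_bound)
  show "integrable T3 (\<lambda>p. 1 + norm (f p) ^ r)"
    by (intro Bochner_Integration.integrable_add integrable_T3_const Lr_even_sym_integrable_power assms)
  have "x \<le> 1 + x ^ r" if "x \<ge> 0" for x :: real
  proof (cases "x \<ge> 1")
    case True
    then have "x ^ 1 \<le> x ^ r" using assms by (intro power_increasing) auto
    then show ?thesis by simp
  next
    case False
    moreover have "x ^ r \<ge> 0" using that by simp
    ultimately show ?thesis by linarith
  qed
  then show "AE p in T3. norm (f p) \<le> norm (1 + norm (f p) ^ r)" by simp
qed (rule Lr_even_sym_measurable[OF assms(1)])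

lemma integrable_bounded_mult:
  assumes "integrable T3 f" and [measurable]: "h \<in> borel_measurable T3" and "\<And>p. \<bar>h p\<bar> \<le> K"
  shows "integrable T3 (\<lambda>p. of_real (h p) * (f p :: complex))"
proof (rule Bochner_Integration.integrable_bound)
  show "integrable T3 (\<lambda>p. of_real K * f p)" using assms(1) by simp
  have "K \<ge> 0" using assms(3)[of 0] by linarith
  then have "\<bar>h p\<bar> \<le> \<bar>K\<bar>" for p using assms(3)[of p] by simp
  then show "AE p in T3. norm (of_real (h p) * f p) \<le> norm (of_real K * f p)"
    by (simp add: norm_mult mult_right_mono)
qed (use assms(1) in measurable)

text \<open>Transposing two coordinates shows that the three cosine moments of \<open>f\<close>
  agree, so each is a third of the moment against \<open>csum\<close>. A perturbation of rank four
  thereby acts with rank two.\<close>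

lemma H_sym:
  assumes f: "f \<in> Lr_even_sym r" and r: "r \<ge> 1"
  shows "H \<mu>\<^sub>1 \<mu>\<^sub>2 f p = of_real (E0 p) * f p + of_real \<mu>\<^sub>1 * cavg f
     + of_real (2 * \<mu>\<^sub>2 / 3) * of_real (csum p) * cavg (\<lambda>q. of_real (csum q) * f q)"
proof -
  note fm [measurable] = Lr_even_sym_measurable[OF f]
  define I where "I = (\<lambda>i. LINT q|T3. of_real (cos (q $ i)) * f q)"
  have I_eq: "I i = I j" for i j
  proof -
    define s where "s = Transposition.transpose i j"
    have s: "bij s" and sj: "s j = i" by (simp_all add: s_def)
    have "AE q in T3. f (\<chi> k. q $ s k) = f q" using f s by (simp add: Lr_even_sym_def)
    then have "I i = (LINT q|T3. of_real (cos ((\<chi> k. q $ s k) $ j)) * f (\<chi> k. q $ s k))"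
    proof -
      assume *: "AE q in T3. f (\<chi> k. q $ s k) = f q"
      have "(\<lambda>q. f (\<chi> k. q $ s k)) \<in> borel_measurable T3"
      proof -
        have T: "(\<lambda>q::real^3. \<chi> k. q $ s k) \<in> borel \<rightarrow>\<^sub>M borel"
          by (intro borel_measurable_continuous_onI continuous_intros)
        \<comment> \<open>Since \<open>f\<close> is only Lebesgue measurable, the permutation has to
          be measurable between the completed measures; this rests on its preserving
          \<open>lborel\<close>.\<close>
        have "(\<lambda>q::real^3. \<chi> k. q $ s k) \<in> T3 \<rightarrow>\<^sub>M T3"
        proof (rule measurable_restrict_space2)
          show "(\<lambda>q. \<chi> k. q $ s k) \<in> space T3 \<rightarrow> torus" by (auto simp: mem_torus)
          show "(\<lambda>q::real^3. \<chi> k. q $ s k) \<in> T3 \<rightarrow>\<^sub>M lebesgue"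
            by (intro measurable_restrict_space1 distr_lebesgue_eq(1)[OF T] lborel_distr_permute s)
        qed
        then show ?thesis by measurable
      qed
      note [measurable] = this
      show ?thesis unfolding I_def
        by (rule integral_cong_AE) (use * in \<open>auto simp: sj\<close>)
    qed
    also have "\<dots> = I j" unfolding I_def
      by (rule integral_permute_T3[OF s, of "\<lambda>q. of_real (cos (q $ j)) * f q"]) measurable
    finally show ?thesis .
  qed
  have int: "integrable T3 (\<lambda>q. of_real (cos (q $ i)) * f q)" for i
    by (rule integrable_bounded_mult[of _ _ 1]) (auto intro: Lr_even_sym_integrable[OF f r])
  have "(LINT q|T3. of_real (csum q) * f q) = (\<Sum>i\<in>UNIV. I i)"
    unfolding I_def by (subst Bochner_Integration.integral_sum[symmetric])
      (auto simp: int csum_def sum_distrib_right)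
  also have "\<dots> = (\<Sum>i\<in>(UNIV::3 set). I 1)" by (intro sum.cong refl I_eq)
  also have "\<dots> = 3 * I 1" by simp
  finally have "I i = (LINT q|T3. of_real (csum q) * f q) / 3" for i using I_eq[of i 1] by simp
  then have "H \<mu>\<^sub>1 \<mu>\<^sub>2 f p = of_real (E0 p) * f p + of_real (\<mu>\<^sub>1 / (2 * pi) ^ 3) * (LINT q|T3. f q)
      + of_real (2 * \<mu>\<^sub>2 / (2 * pi) ^ 3) * (of_real (csum p) * ((LINT q|T3. of_real (csum q) * f q) / 3))"
    unfolding H_def I_def[symmetric] csum_def of_real_sum sum_distrib_right by (simp only: I_def)
  then show ?thesis by (simp add: cavg_def)
qed

lemma Lr_even_symI:
  assumes f: "f = (\<lambda>p. F (csum p))" and "f \<in> borel_measurable T3" and "integrable T3 (\<lambda>p. norm (f p) ^ r)"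
  shows "f \<in> Lr_even_sym r"
  using assms(2,3) unfolding f by (simp add: Lr_even_sym_def Lr_even_def csum_uminus csum_permute)

lemma integrable_norm_sq_bound:
  fixes f g :: torus_fun
  assumes f: "integrable T3 (\<lambda>p. (norm (f p))\<^sup>2)" and g: "g \<in> borel_measurable T3"
    and le: "AE p in T3. norm (g p) \<le> a * norm (f p) + b"
  shows "integrable T3 (\<lambda>p. (norm (g p))\<^sup>2)"
proof (rule Bochner_Integration.integrable_bound)
  show "integrable T3 (\<lambda>p. 2 * a\<^sup>2 * (norm (f p))\<^sup>2 + 2 * b\<^sup>2)"
    using f by simp
  show "AE p in T3. norm ((norm (g p))\<^sup>2) \<le> norm (2 * a\<^sup>2 * (norm (f p))\<^sup>2 + 2 * b\<^sup>2)"
    using le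
  proof (rule AE_mp, intro AE_I2 impI)
    fix p assume "norm (g p) \<le> a * norm (f p) + b"
    then have "(norm (g p))\<^sup>2 \<le> (a * norm (f p) + b)\<^sup>2" by (intro power_mono) auto
    also have "\<dots> \<le> 2 * a\<^sup>2 * (norm (f p))\<^sup>2 + 2 * b\<^sup>2"
      using sum_squares_bound[of "a * norm (f p)" b] by (simp add: power2_sum power_mult_distrib)
    finally show "norm ((norm (g p))\<^sup>2) \<le> norm (2 * a\<^sup>2 * (norm (f p))\<^sup>2 + 2 * b\<^sup>2)"
      by simp
  qed
qed (use g in measurable)

lemma integrable_csum_green: "w \<ge> 12 \<Longrightarrow> integrable T3 (\<lambda>p. csum p * green w p)"
  using integrable_csum_power_mult[OF integrable_green, of w 1] by simp

text \<open>
  Since \<open>E0 - (12 - w)\<close> and \<open>csum\<close> are affine functions of each other, a solution of the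
  resolvent equation is \<open>green w\<close> times \<open>g\<close> plus a combination of \<open>green w\<close> and a constant.
\<close>

lemma cavg_ansatz:
  assumes w: "w \<ge> 12" and g: "integrable T3 (\<lambda>p. of_real (green w p) * g p)"
    and f: "AE p in T3. f p = of_real (green w p) * (g p + u) + v" and fm: "f \<in> borel_measurable T3"
  shows "cavg f = cavg (\<lambda>p. of_real (green w p) * g p) + u * of_real (gA w) + v"
    and "cavg (\<lambda>p. of_real (csum p) * f p)
      = cavg (\<lambda>p. of_real (csum p) * (of_real (green w p) * g p)) + u * of_real (gB w)"
proof -
  note [measurable] = fm
  have gm [measurable]: "(\<lambda>p. of_real (green w p) * g p) \<in> borel_measurable T3" using g by measurable
  note int = integrable_green[OF w] integrable_csum_green[OF w]
  have "cavg f = cavg (\<lambda>p. of_real (green w p) * g p + of_real (green w p) * u + v)"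
  proof (rule cavg_cong_AE)
    show "AE p in T3. f p = of_real (green w p) * g p + of_real (green w p) * u + v"
      using f by (rule AE_mp) (auto intro!: AE_I2 simp: algebra_simps)
  qed measurable
  also have "\<dots> = cavg (\<lambda>p. of_real (green w p) * g p) + u * of_real (gA w) + v"
    using g int by (simp add: cavg_add gA_def)
  finally show "cavg f = cavg (\<lambda>p. of_real (green w p) * g p) + u * of_real (gA w) + v" .
  have cg: "integrable T3 (\<lambda>p. of_real (csum p) * (of_real (green w p) * g p))"
    by (rule integrable_bounded_mult[OF g _ csum_bounds]) measurable
  have "cavg (\<lambda>p. of_real (csum p) * f p) = cavg (\<lambda>p. of_real (csum p) * (of_real (green w p) * g p)
      + of_real (csum p * green w p) * u + of_real (csum p) * v)"
  proof (rule cavg_cong_AE)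
    show "AE p in T3. of_real (csum p) * f p = of_real (csum p) * (of_real (green w p) * g p)
      + of_real (csum p * green w p) * u + of_real (csum p) * v"
      using f by (rule AE_mp) (auto intro!: AE_I2 simp: algebra_simps)
  qed measurable
  also have "\<dots> = cavg (\<lambda>p. of_real (csum p) * (of_real (green w p) * g p)) + u * of_real (gB w)"
    using cg int by (simp add: cavg_add gB_def del: of_real_mult)
  finally show "cavg (\<lambda>p. of_real (csum p) * f p)
      = cavg (\<lambda>p. of_real (csum p) * (of_real (green w p) * g p)) + u * of_real (gB w)" .
qed

lemma AE_green_cancel_complex:
  assumes "w \<ge> 12"
  shows "AE p in T3. complex_of_real (w - 4 * csum p) * of_real (green w p) = 1"
  using AE_green_cancel[OF assms] by (simp flip: of_real_mult of_real_diff)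

text \<open>Allowing \<open>w = 12\<close> and any \<open>r \<ge> 1\<close> lets one statement serve
  the resolvent, the eigenfunctions and the resonance. The condition on \<open>v\<close> matches the
  moment against \<open>csum\<close>; the one on \<open>u\<close> makes the leftover constant
  \<open>u + w * v + \<mu>\<^sub>1 * x\<close> vanish, with \<open>x\<close> the average of
  \<open>f\<close>.\<close>

lemma resolvent_equation_solution:
  assumes w: "w \<ge> 12" and g: "integrable T3 (\<lambda>p. of_real (green w p) * g p)"
    and f: "f \<in> Lr_even_sym r" "r \<ge> 1" "\<And>p. f p = of_real (green w p) * (g p + u) + v"
    and v: "v = of_real (\<mu>\<^sub>2 / 6) * (cavg (\<lambda>p. of_real (csum p) * (of_real (green w p) * g p)) + u * of_real (gB w))"
    and u: "u * of_real (Delta \<mu>\<^sub>1 \<mu>\<^sub>2 w) = - (of_real \<mu>\<^sub>1 * cavg (\<lambda>p. of_real (green w p) * g p)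
        + of_real (\<mu>\<^sub>2 / 6 * (w + \<mu>\<^sub>1)) * cavg (\<lambda>p. of_real (csum p) * (of_real (green w p) * g p)))"
  shows "AE p in T3. H \<mu>\<^sub>1 \<mu>\<^sub>2 f p - of_real (12 - w) * f p = g p"
proof -
  define g1 where "g1 = cavg (\<lambda>p. of_real (green w p) * g p)"
  define g2 where "g2 = cavg (\<lambda>p. of_real (csum p) * (of_real (green w p) * g p))"
  define x where "x = cavg f"
  define y where "y = cavg (\<lambda>p. of_real (csum p) * f p)"
  note ansatz = cavg_ansatz[OF w g AE_I2[OF f(3)] Lr_even_sym_measurable[OF f(1)], folded g1_def g2_def x_def y_def]
  have vy: "v = of_real (\<mu>\<^sub>2 / 6) * y" using v ansatz by (simp add: g2_def)
  have ux: "u + of_real w * v + of_real \<mu>\<^sub>1 * x = 0"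
  proof -
    have "u + of_real w * v + of_real \<mu>\<^sub>1 * x = u * of_real (Delta \<mu>\<^sub>1 \<mu>\<^sub>2 w) + (of_real \<mu>\<^sub>1 * g1 + of_real (\<mu>\<^sub>2 / 6 * (w + \<mu>\<^sub>1)) * g2)"
      unfolding v[folded g2_def] ansatz by (simp add: Delta_def algebra_simps add_divide_distrib)
    then show ?thesis using u by (simp add: g1_def g2_def)
  qed
  show ?thesis using AE_green_cancel_complex[OF w]
  proof (rule AE_mp, intro AE_I2 impI)
    fix p assume c: "complex_of_real (w - 4 * csum p) * of_real (green w p) = 1"
    define C where "C = complex_of_real (csum p)"
    have "H \<mu>\<^sub>1 \<mu>\<^sub>2 f p - of_real (12 - w) * f p
       = of_real (w - 4 * csum p) * f p + of_real \<mu>\<^sub>1 * x + of_real (2 * \<mu>\<^sub>2 / 3) * C * y"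
      unfolding H_sym[OF f(1,2)] x_def y_def C_def by (simp add: E0_eq algebra_simps)
    also have "of_real (w - 4 * csum p) * f p = (of_real (w - 4 * csum p) * of_real (green w p)) * (g p + u) + of_real (w - 4 * csum p) * v"
      by (simp only: f(3) distrib_left mult.assoc)
    also have "\<dots> = g p + u + (of_real w - 4 * C) * v" unfolding c by (simp add: C_def)
    also have "\<dots> + of_real \<mu>\<^sub>1 * x + of_real (2 * \<mu>\<^sub>2 / 3) * C * y
       = g p + (u + of_real w * v + of_real \<mu>\<^sub>1 * x) + 4 * C * (of_real (\<mu>\<^sub>2 / 6) * y - v)"
      by (simp add: algebra_simps)
    also have "\<dots> = g p" unfolding ux by (simp add: vy)
    finally show "H \<mu>\<^sub>1 \<mu>\<^sub>2 f p - of_real (12 - w) * f p = g p" .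
  qed
qed

lemma resolvent_equation_form:
  assumes w: "w \<ge> 12" and g: "integrable T3 (\<lambda>p. of_real (green w p) * g p)"
    and f: "f \<in> Lr_even_sym r" "r \<ge> 1" and eq: "AE p in T3. H \<mu>\<^sub>1 \<mu>\<^sub>2 f p - of_real (12 - w) * f p = g p"
  obtains u v where "AE p in T3. f p = of_real (green w p) * (g p + u) + v"
    and "v = of_real (\<mu>\<^sub>2 / 6) * (cavg (\<lambda>p. of_real (csum p) * (of_real (green w p) * g p)) + u * of_real (gB w))"
    and "u * of_real (Delta \<mu>\<^sub>1 \<mu>\<^sub>2 w) = - (of_real \<mu>\<^sub>1 * cavg (\<lambda>p. of_real (green w p) * g p)
        + of_real (\<mu>\<^sub>2 / 6 * (w + \<mu>\<^sub>1)) * cavg (\<lambda>p. of_real (csum p) * (of_real (green w p) * g p)))"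
proof -
  define g1 where "g1 = cavg (\<lambda>p. of_real (green w p) * g p)"
  define g2 where "g2 = cavg (\<lambda>p. of_real (csum p) * (of_real (green w p) * g p))"
  define x where "x = cavg f"
  define y where "y = cavg (\<lambda>p. of_real (csum p) * f p)"
  define v where "v = of_real (\<mu>\<^sub>2 / 6) * y"
  \<comment> \<open>Writing \<open>4 * csum\<close> as \<open>w - (w - 4 * csum)\<close> splits the
    term \<open>4 * csum * v\<close> into a constant, collected in \<open>u\<close>, and a multiple
    of \<open>w - 4 * csum\<close>, which becomes the additive \<open>v\<close> once that factor is
    divided out.\<close>
  define u where "u = - of_real \<mu>\<^sub>1 * x - of_real w * v"
  have f_eq: "AE p in T3. f p = of_real (green w p) * (g p + u) + v"
    using eq AE_green_cancel_complex[OF w]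
  proof eventually_elim
    fix p assume h: "H \<mu>\<^sub>1 \<mu>\<^sub>2 f p - of_real (12 - w) * f p = g p"
      and c: "complex_of_real (w - 4 * csum p) * of_real (green w p) = 1"
    define C where "C = complex_of_real (csum p)"
    define G where "G = complex_of_real (green w p)"
    have "g p = of_real (w - 4 * csum p) * f p + of_real \<mu>\<^sub>1 * x + of_real (2 * \<mu>\<^sub>2 / 3) * C * y"
      unfolding h[symmetric] H_sym[OF f(1,2)] x_def y_def C_def by (simp add: E0_eq algebra_simps)
    then have "g p + u + of_real (w - 4 * csum p) * v = of_real (w - 4 * csum p) * f p"
      by (simp add: u_def v_def C_def algebra_simps)
    then have "G * (g p + u) + (of_real (w - 4 * csum p) * G) * v = (of_real (w - 4 * csum p) * G) * f p"
      by (metis (no_types, opaque_lifting) distrib_left mult.assoc mult.commute)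
    then show "f p = of_real (green w p) * (g p + u) + v"
      using c by (simp add: G_def)
  qed
  note ansatz = cavg_ansatz[OF w g f_eq Lr_even_sym_measurable[OF f(1)], folded g1_def g2_def x_def y_def]
  have v: "v = of_real (\<mu>\<^sub>2 / 6) * (g2 + u * of_real (gB w))" using ansatz by (simp add: v_def)
  have "u + of_real w * v + of_real \<mu>\<^sub>1 * x = 0" by (simp add: u_def)
  then have "u + of_real w * v + of_real \<mu>\<^sub>1 * (g1 + u * of_real (gA w) + v) = 0" by (simp only: ansatz)
  then have "u + of_real \<mu>\<^sub>1 * (g1 + u * of_real (gA w)) + of_real (w + \<mu>\<^sub>1) * v = 0" by (simp add: algebra_simps)
  then have "u * of_real (Delta \<mu>\<^sub>1 \<mu>\<^sub>2 w) + (of_real \<mu>\<^sub>1 * g1 + of_real (\<mu>\<^sub>2 / 6 * (w + \<mu>\<^sub>1)) * g2) = 0"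
    unfolding v by (simp add: Delta_def algebra_simps add_divide_distrib)
  then have "u * of_real (Delta \<mu>\<^sub>1 \<mu>\<^sub>2 w) = - (of_real \<mu>\<^sub>1 * g1 + of_real (\<mu>\<^sub>2 / 6 * (w + \<mu>\<^sub>1)) * g2)"
    by (simp only: eq_neg_iff_add_eq_0)
  then show thesis using that[OF f_eq] v unfolding g1_def g2_def by blast
qed

section \<open>Square-integrable estimates and the resolvent below zero\<close>

abbreviation (input) L2s :: "torus_fun set" where "L2s \<equiv> Lr_even_sym 2"

lemma green_le:
  assumes "w > 12" shows "\<bar>green w p\<bar> \<le> 1 / (w - 12)"
  using csum_bounds[of p] assms by (auto simp: green_def abs_le_iff intro!: frac_le)

lemma AE_L2norm_eq_0:
  assumes "f \<in> L2s" and "L2norm f \<le> 0"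
  shows "AE p in T3. f p = 0"
proof -
  have "(LINT p|T3. (norm (f p))\<^sup>2) \<le> 0" using assms(2) by (simp add: L2norm_def)
  then have "(LINT p|T3. (norm (f p))\<^sup>2) = 0" by (intro antisym) simp_all
  then have "AE p in T3. (norm (f p))\<^sup>2 = 0"
    by (subst (asm) integral_nonneg_eq_0_iff_AE[OF Lr_even_sym_integrable_power[OF assms(1)]]) auto
  then show ?thesis by simp
qed

lemma L2norm_AE_0: "AE p in T3. g p = 0 \<Longrightarrow> L2norm g = 0"
  by (simp add: L2norm_def) (rule integral_eq_zero_AE, simp)

lemma L2norm_mono:
  assumes "integrable T3 (\<lambda>p. (norm (g p))\<^sup>2)" and "AE p in T3. norm (f p) \<le> K * norm (g p)"
    and "f \<in> borel_measurable T3" and K: "K \<ge> 0"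
  shows "L2norm f \<le> K * L2norm g"
proof -
  have "integrable T3 (\<lambda>p. (norm (f p))\<^sup>2)"
    by (rule integrable_norm_sq_bound[OF assms(1,3), of K 0]) (use assms(2) in simp)
  then have "(LINT p|T3. (norm (f p))\<^sup>2) \<le> (LINT p|T3. K\<^sup>2 * (norm (g p))\<^sup>2)"
  proof (rule integral_mono_AE)
    show "AE p in T3. (norm (f p))\<^sup>2 \<le> K\<^sup>2 * (norm (g p))\<^sup>2"
      using assms(2) by (rule AE_mp) (auto intro!: AE_I2 power_mono simp flip: power_mult_distrib)
  qed (use assms(1) in simp)
  then have "L2norm f \<le> sqrt (K\<^sup>2 * (LINT p|T3. (norm (g p))\<^sup>2))" by (simp add: L2norm_def)
  then show ?thesis using K by (simp add: L2norm_def real_sqrt_mult)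
qed

text \<open>The rank two part of the resolvent adds constants controlled by the mean of
  \<open>norm (g p)\<close>. The square of that mean is at most the mean square, and
  \<open>(a + b)\<^sup>2 \<le> 2 * a\<^sup>2 + 2 * b\<^sup>2\<close> accounts for the factor
  2.\<close>

lemma L2norm_le_of_pointwise:
  assumes g: "integrable T3 (\<lambda>p. (norm (g p))\<^sup>2)" "g \<in> borel_measurable T3" and f: "f \<in> borel_measurable T3"
    and K: "K \<ge> 0" and le: "AE p in T3. norm (f p) \<le> K * (norm (g p) + avg (\<lambda>q. norm (g q)))"
  shows "L2norm f \<le> 2 * K * L2norm g"
proof -
  define N where "N = avg (\<lambda>q. norm (g q))"
  note [measurable] = g(2) f
  have gi: "integrable T3 (\<lambda>p. norm (g p))"
  proof (rule Bochner_Integration.integrable_bound)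
    show "integrable T3 (\<lambda>p. 1 + (norm (g p))\<^sup>2)" using g by simp
    have "x \<le> 1 + x\<^sup>2" for x :: real using zero_le_power2[of "x - 1/2"] by (simp add: power2_eq_square algebra_simps)
    then show "AE p in T3. norm (norm (g p)) \<le> norm (1 + (norm (g p))\<^sup>2)" by simp
  qed measurable
  have N: "N\<^sup>2 \<le> avg (\<lambda>p. (norm (g p))\<^sup>2)"
  proof -
    have "avg (\<lambda>p. 0) \<le> avg (\<lambda>p. (norm (g p))\<^sup>2 - 2 * N * norm (g p) + N\<^sup>2)"
    proof (rule avg_mono_AE)
      show "AE p in T3. 0 \<le> (norm (g p))\<^sup>2 - 2 * N * norm (g p) + N\<^sup>2"
        using zero_le_power2[of "norm (g p) - N" for p]
        by (intro AE_I2) (simp add: power2_diff algebra_simps)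
    qed (use g gi in auto)
    also have "\<dots> = avg (\<lambda>p. (norm (g p))\<^sup>2) - 2 * N * N + N\<^sup>2"
      using g gi by (simp add: avg_add avg_diff N_def[symmetric])
    finally show ?thesis by (simp add: power2_eq_square)
  qed
  define h where "h = (\<lambda>p. 2 * K\<^sup>2 * (norm (g p))\<^sup>2 + 2 * K\<^sup>2 * N\<^sup>2)"
  have hi: "integrable T3 h" unfolding h_def using g by simp
  have fh: "AE p in T3. (norm (f p))\<^sup>2 \<le> h p"
    using le
  proof (rule AE_mp, intro AE_I2 impI)
    fix p assume "norm (f p) \<le> K * (norm (g p) + avg (\<lambda>q. norm (g q)))"
    then have "(norm (f p))\<^sup>2 \<le> (K * (norm (g p) + N))\<^sup>2" unfolding N_def by (intro power_mono) auto
    also have "\<dots> = K\<^sup>2 * (norm (g p) + N)\<^sup>2" by (simp add: power_mult_distrib)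
    also have "\<dots> \<le> K\<^sup>2 * (2 * (norm (g p))\<^sup>2 + 2 * N\<^sup>2)"
      using sum_squares_bound[of "norm (g p)" N] by (intro mult_left_mono) (auto simp: power2_sum)
    finally show "(norm (f p))\<^sup>2 \<le> h p" by (simp add: h_def algebra_simps)
  qed
  have "integrable T3 (\<lambda>p. (norm (f p))\<^sup>2)"
    by (rule Bochner_Integration.integrable_bound[OF hi]) (measurable, rule AE_mp[OF fh], auto intro!: AE_I2)
  then have "avg (\<lambda>p. (norm (f p))\<^sup>2) \<le> avg h" using hi fh by (rule avg_mono_AE)
  also have "\<dots> = 2 * K\<^sup>2 * avg (\<lambda>p. (norm (g p))\<^sup>2) + 2 * K\<^sup>2 * N\<^sup>2"
    unfolding h_def using g by (simp add: avg_add)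
  also have "\<dots> \<le> (2 * K)\<^sup>2 * avg (\<lambda>p. (norm (g p))\<^sup>2)"
    using mult_left_mono[OF N, of "2 * K\<^sup>2"] by (simp add: power2_eq_square)
  finally have "(LINT p|T3. (norm (f p))\<^sup>2) \<le> (2 * K)\<^sup>2 * (LINT p|T3. (norm (g p))\<^sup>2)"
    unfolding avg_def times_divide_eq_right
    by (rule divide_le_cancel[THEN iffD1, THEN conjunct1, rule_format]) simp
  then have "L2norm f \<le> sqrt ((2 * K)\<^sup>2 * (LINT p|T3. (norm (g p))\<^sup>2))" by (simp add: L2norm_def)
  also have "\<dots> = 2 * K * L2norm g" using K by (simp add: L2norm_def real_sqrt_mult)
  finally show ?thesis .
qed

lemma integrable_green_mult:
  fixes g :: torus_fun
  assumes "w > 12" "integrable T3 g"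
  shows "integrable T3 (\<lambda>p. of_real (green w p) * g p)"
  by (rule integrable_bounded_mult[OF assms(2) _ green_le[OF assms(1)]]) measurable

lemma ansatz_in_L2s:
  assumes w: "w > 12" and g: "g \<in> L2s"
  shows "(\<lambda>p. of_real (green w p) * (g p + u) + v) \<in> L2s" (is "?f \<in> _")
proof -
  note [measurable] = Lr_even_sym_measurable[OF g]
  have m: "?f \<in> borel_measurable T3" by measurable
  have "integrable T3 (\<lambda>p. (norm (?f p))\<^sup>2)"
  proof (rule integrable_norm_sq_bound[OF Lr_even_sym_integrable_power[OF g] m])
    show "AE p in T3. norm (?f p) \<le> 1 / (w - 12) * norm (g p) + (1 / (w - 12) * norm u + norm v)"
    proof (intro AE_I2)
      fix p
      have "norm (?f p) \<le> \<bar>green w p\<bar> * norm (g p + u) + norm v"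
        by (rule norm_triangle_le) (simp add: norm_mult)
      also have "\<dots> \<le> 1 / (w - 12) * (norm (g p) + norm u) + norm v"
        using w by (intro add_right_mono mult_mono green_le norm_triangle_ineq) auto
      finally show "norm (?f p) \<le> 1 / (w - 12) * norm (g p) + (1 / (w - 12) * norm u + norm v)"
        by (simp add: algebra_simps add_divide_distrib)
    qed
  qed
  moreover have "AE p in T3. ?f (- p) = ?f p"
    using g by (auto simp: Lr_even_sym_def Lr_even_def green_def csum_uminus)
  moreover have "AE p in T3. ?f (\<chi> i. p $ s i) = ?f p" if "bij s" for s
    using g that by (auto simp: Lr_even_sym_def green_def csum_permute)
  ultimately show ?thesis using m by (simp add: Lr_even_sym_def Lr_even_def)
qed

lemma H_measurable:
  assumes [measurable]: "f \<in> borel_measurable T3"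
  shows "H \<mu>\<^sub>1 \<mu>\<^sub>2 f \<in> borel_measurable T3"
  unfolding H_def[abs_def] by measurable

lemma H_shift_L2:
  assumes f: "f \<in> L2s"
  shows "integrable T3 (\<lambda>p. (norm (H \<mu>\<^sub>1 \<mu>\<^sub>2 f p - of_real z * f p))\<^sup>2)"
proof (rule integrable_norm_sq_bound)
  note [measurable] = Lr_even_sym_measurable[OF f] H_measurable[OF Lr_even_sym_measurable[OF f]]
  show "integrable T3 (\<lambda>p. (norm (f p))\<^sup>2)" using Lr_even_sym_integrable_power[OF f] .
  show "(\<lambda>p. H \<mu>\<^sub>1 \<mu>\<^sub>2 f p - of_real z * f p) \<in> borel_measurable T3" by measurable
  define x where "x = of_real \<mu>\<^sub>1 * cavg f"
  define y where "y = of_real (2 * \<mu>\<^sub>2 / 3) * cavg (\<lambda>q. of_real (csum q) * f q)"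
  show "AE p in T3. norm (H \<mu>\<^sub>1 \<mu>\<^sub>2 f p - of_real z * f p) \<le> (24 + \<bar>z\<bar>) * norm (f p) + (norm x + 3 * norm y)"
  proof (intro AE_I2)
    fix p
    have eq: "H \<mu>\<^sub>1 \<mu>\<^sub>2 f p - of_real z * f p = of_real (E0 p - z) * f p + x + of_real (csum p) * y"
      using H_sym[OF f, of \<mu>\<^sub>1 \<mu>\<^sub>2 p] by (simp add: x_def y_def algebra_simps)
    have "norm (H \<mu>\<^sub>1 \<mu>\<^sub>2 f p - of_real z * f p) \<le> \<bar>E0 p - z\<bar> * norm (f p) + norm x + \<bar>csum p\<bar> * norm y"
      unfolding eq by (intro norm_triangle_le add_mono) (auto simp: norm_mult simp del: of_real_diff)
    also have "\<dots> \<le> (24 + \<bar>z\<bar>) * norm (f p) + norm x + 3 * norm y"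
      using csum_bounds[of p] by (intro add_mono mult_right_mono) (auto simp: E0_eq)
    finally show "norm (H \<mu>\<^sub>1 \<mu>\<^sub>2 f p - of_real z * f p) \<le> (24 + \<bar>z\<bar>) * norm (f p) + (norm x + 3 * norm y)"
      by simp
  qed
qed

text \<open>Absence of an eigenvalue would not suffice: a discrete eigenvalue must be isolated in
  the whole spectrum, so the rest of the negative axis has to lie in the resolvent set.\<close>

lemma resolvent_set_below:
  assumes z: "z < 0" and D: "Delta \<mu>\<^sub>1 \<mu>\<^sub>2 (12 - z) \<noteq> 0"
  shows "z \<in> resolvent_set (H \<mu>\<^sub>1 \<mu>\<^sub>2) L2s"
proof -
  define w where "w = 12 - z"
  have w: "w > 12" "w \<ge> 12" using z by (auto simp: w_def)
  have zw: "z = 12 - w" by (simp add: w_def)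
  define D where "D = Delta \<mu>\<^sub>1 \<mu>\<^sub>2 w"
  have D0: "D \<noteq> 0" using D by (simp add: D_def w_def)
  have surj: "\<exists>f \<in> L2s. AE p in T3. H \<mu>\<^sub>1 \<mu>\<^sub>2 f p - of_real z * f p = g p" if g: "g \<in> L2s" for g
  proof -
    have gi: "integrable T3 (\<lambda>p. of_real (green w p) * g p)"
      using integrable_green_mult[OF w(1)] Lr_even_sym_integrable[OF g] by simp
    define u where "u = - (of_real \<mu>\<^sub>1 * cavg (\<lambda>p. of_real (green w p) * g p)
        + of_real (\<mu>\<^sub>2 / 6 * (w + \<mu>\<^sub>1)) * cavg (\<lambda>p. of_real (csum p) * (of_real (green w p) * g p))) / of_real D"
    define v where "v = of_real (\<mu>\<^sub>2 / 6) * (cavg (\<lambda>p. of_real (csum p) * (of_real (green w p) * g p)) + u * of_real (gB w))"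
    have "AE p in T3. H \<mu>\<^sub>1 \<mu>\<^sub>2 (\<lambda>p. of_real (green w p) * (g p + u) + v) p
        - of_real (12 - w) * (of_real (green w p) * (g p + u) + v) = g p"
      by (rule resolvent_equation_solution[OF w(2) gi ansatz_in_L2s[OF w(1) g] _ _ v_def])
         (use D0 in \<open>simp_all add: u_def D_def\<close>)
    then show ?thesis using ansatz_in_L2s[OF w(1) g] unfolding zw by blast
  qed
  define d where "d = 1 / (w - 12)"
  have d: "d > 0" using w by (simp add: d_def)
  \<comment> \<open>With \<open>N\<close> the mean of \<open>norm (g p)\<close>,
    \<open>U * N\<close> and \<open>W * N\<close> bound the constants \<open>u\<close> and
    \<open>v\<close> of the solution; \<open>d\<close> bounds \<open>green w\<close>, and
    \<open>3 * d\<close> bounds \<open>csum p * green w p\<close>.\<close>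
  define U where "U = (\<bar>\<mu>\<^sub>1\<bar> * d + \<bar>\<mu>\<^sub>2 / 6 * (w + \<mu>\<^sub>1)\<bar> * (3 * d)) / \<bar>D\<bar>"
  define W where "W = \<bar>\<mu>\<^sub>2 / 6\<bar> * (3 * d + U * \<bar>gB w\<bar>)"
  define K where "K = d + d * U + W"
  have UW: "U \<ge> 0" "W \<ge> 0" using d by (simp_all add: U_def W_def)
  have K: "K \<ge> 0" using d UW by (simp add: K_def)
  have bound: "L2norm f \<le> 2 * K * L2norm (\<lambda>p. H \<mu>\<^sub>1 \<mu>\<^sub>2 f p - of_real z * f p)" if f: "f \<in> L2s" for f
  proof -
    define g where "g = (\<lambda>p. H \<mu>\<^sub>1 \<mu>\<^sub>2 f p - of_real z * f p)"
    note [measurable] = Lr_even_sym_measurable[OF f] H_measurable[OF Lr_even_sym_measurable[OF f]]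
    have gm [measurable]: "g \<in> borel_measurable T3" unfolding g_def by measurable
    have g2: "integrable T3 (\<lambda>p. (norm (g p))\<^sup>2)" unfolding g_def by (rule H_shift_L2[OF f])
    have gi: "integrable T3 g"
    proof (rule Bochner_Integration.integrable_bound)
      show "integrable T3 (\<lambda>p. 1 + (norm (g p))\<^sup>2)" using g2 by simp
      have "x \<le> 1 + x\<^sup>2" for x :: real using zero_le_power2[of "x - 1/2"] by (simp add: power2_eq_square algebra_simps)
      then show "AE p in T3. norm (g p) \<le> norm (1 + (norm (g p))\<^sup>2)" by simp
    qed measurable
    define N where "N = avg (\<lambda>q. norm (g q))"
    have Gi: "integrable T3 (\<lambda>p. of_real (green w p) * g p)" by (rule integrable_green_mult[OF w(1) gi])
    define g1 where "g1 = cavg (\<lambda>p. of_real (green w p) * g p)"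
    define g2' where "g2' = cavg (\<lambda>p. of_real (csum p) * (of_real (green w p) * g p))"
    have eq: "AE p in T3. H \<mu>\<^sub>1 \<mu>\<^sub>2 f p - of_real (12 - w) * f p = g p" by (simp add: g_def zw)
    obtain u v where uv: "AE p in T3. f p = of_real (green w p) * (g p + u) + v"
      "v = of_real (\<mu>\<^sub>2 / 6) * (g2' + u * of_real (gB w))"
      "u * of_real D = - (of_real \<mu>\<^sub>1 * g1 + of_real (\<mu>\<^sub>2 / 6 * (w + \<mu>\<^sub>1)) * g2')"
      by (rule resolvent_equation_form[OF w(2) Gi f one_le_numeral eq, folded g1_def g2'_def D_def])
    have avg_le: "avg (\<lambda>p. norm (of_real (h p) * g p)) \<le> c * N"
      if [measurable]: "h \<in> borel_measurable T3" and h: "\<And>p. \<bar>h p\<bar> \<le> c" for h c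
    proof -
      have "avg (\<lambda>p. norm (of_real (h p) * g p)) \<le> avg (\<lambda>p. c * norm (g p))"
        by (intro avg_mono_AE integrable_norm integrable_mult_right integrable_bounded_mult[OF gi that] gi AE_I2)
           (simp add: norm_mult mult_right_mono h)
      then show ?thesis by (simp add: N_def)
    qed
    have g1: "norm g1 \<le> d * N"
      unfolding g1_def d_def by (intro order_trans[OF norm_cavg_le] avg_le green_le w) measurable
    have g2': "norm g2' \<le> 3 * d * N"
    proof -
      have "\<bar>csum p * green w p\<bar> \<le> 3 * d" for p
        unfolding abs_mult d_def using w by (intro mult_mono csum_bounds green_le) auto
      then have "norm (cavg (\<lambda>p. of_real (csum p * green w p) * g p)) \<le> 3 * d * N"
        by (intro order_trans[OF norm_cavg_le] avg_le) measurable
      then show ?thesis by (simp add: g2'_def mult.assoc)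
    qed
    have N: "N \<ge> 0" unfolding N_def avg_def by (intro divide_nonneg_nonneg Bochner_Integration.integral_nonneg) auto
    have "norm u * \<bar>D\<bar> = norm (of_real \<mu>\<^sub>1 * g1 + of_real (\<mu>\<^sub>2 / 6 * (w + \<mu>\<^sub>1)) * g2')"
      using arg_cong[OF uv(3), of norm] by (simp only: norm_mult norm_of_real norm_minus_cancel)
    also have "\<dots> \<le> \<bar>\<mu>\<^sub>1\<bar> * norm g1 + \<bar>\<mu>\<^sub>2 / 6 * (w + \<mu>\<^sub>1)\<bar> * norm g2'"
      by (intro norm_triangle_le) (simp only: norm_mult norm_of_real)
    also have "\<dots> \<le> \<bar>\<mu>\<^sub>1\<bar> * (d * N) + \<bar>\<mu>\<^sub>2 / 6 * (w + \<mu>\<^sub>1)\<bar> * (3 * d * N)"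
      by (intro add_mono mult_left_mono g1 g2') auto
    also have "\<dots> = U * \<bar>D\<bar> * N"
    proof -
      have "U * \<bar>D\<bar> = \<bar>\<mu>\<^sub>1\<bar> * d + \<bar>\<mu>\<^sub>2 / 6 * (w + \<mu>\<^sub>1)\<bar> * (3 * d)" using D0 by (simp add: U_def)
      then show ?thesis by (simp only: distrib_right mult.assoc)
    qed
    also have "\<dots> = U * N * \<bar>D\<bar>" by simp
    finally have u: "norm u \<le> U * N" using D0 by simp
    have "norm v = \<bar>\<mu>\<^sub>2 / 6\<bar> * norm (g2' + u * of_real (gB w))" unfolding uv(2) norm_mult norm_of_real ..
    also have "\<dots> \<le> \<bar>\<mu>\<^sub>2 / 6\<bar> * (norm g2' + norm u * \<bar>gB w\<bar>)"
      by (intro mult_left_mono norm_triangle_le) (auto simp: norm_mult)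
    also have "\<dots> \<le> \<bar>\<mu>\<^sub>2 / 6\<bar> * (3 * d * N + (U * N) * \<bar>gB w\<bar>)"
      by (intro mult_left_mono add_mono mult_right_mono g2' u) auto
    also have "\<dots> = W * N" by (simp add: W_def algebra_simps)
    finally have v: "norm v \<le> W * N" .
    have "AE p in T3. norm (f p) \<le> K * (norm (g p) + N)"
      using uv(1)
    proof (rule AE_mp, intro AE_I2 impI)
      fix p assume "f p = of_real (green w p) * (g p + u) + v"
      then have "norm (f p) \<le> \<bar>green w p\<bar> * norm (g p + u) + norm v"
        by (simp only:) (rule norm_triangle_le, simp add: norm_mult)
      also have "\<dots> \<le> d * (norm (g p) + U * N) + W * N"
        using d u by (intro add_mono mult_mono norm_triangle_le v) (auto simp: d_def green_le w)
      also have "\<dots> = d * norm (g p) + (d * U + W) * N" by (simp add: algebra_simps)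
      also have "\<dots> \<le> K * norm (g p) + K * N"
        using UW d N by (intro add_mono mult_right_mono) (auto simp: K_def)
      finally show "norm (f p) \<le> K * (norm (g p) + N)" by (simp add: algebra_simps)
    qed
    then have "L2norm f \<le> 2 * K * L2norm g"
      unfolding N_def by (intro L2norm_le_of_pointwise g2 K) measurable
    then show ?thesis by (simp add: g_def)
  qed
  show ?thesis unfolding resolvent_set_def using surj bound by blast
qed

section \<open>Spectrum and eigenvalues\<close>

lemma eigenspace_L2s_form:
  assumes z: "z < 0" and f: "f \<in> eigenspace (H \<mu>\<^sub>1 \<mu>\<^sub>2) L2s z"
  obtains u where "AE p in T3. f p = u * of_real (green (12 - z) p + \<mu>\<^sub>2 / 6 * gB (12 - z))"
    and "u * of_real (Delta \<mu>\<^sub>1 \<mu>\<^sub>2 (12 - z)) = 0"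
proof -
  have w: "12 - z \<ge> 12" using z by simp
  have f2: "f \<in> L2s" using f by (simp add: eigenspace_def)
  have eq: "AE p in T3. H \<mu>\<^sub>1 \<mu>\<^sub>2 f p - of_real (12 - (12 - z)) * f p = 0"
    using f by (simp add: eigenspace_def)
  obtain u v where uv: "AE p in T3. f p = of_real (green (12 - z) p) * (0 + u) + v"
    "v = of_real (\<mu>\<^sub>2 / 6) * (cavg (\<lambda>p. of_real (csum p) * (of_real (green (12 - z) p) * 0)) + u * of_real (gB (12 - z)))"
    "u * of_real (Delta \<mu>\<^sub>1 \<mu>\<^sub>2 (12 - z)) = - (of_real \<mu>\<^sub>1 * cavg (\<lambda>p. of_real (green (12 - z) p) * 0)
        + of_real (\<mu>\<^sub>2 / 6 * (12 - z + \<mu>\<^sub>1)) * cavg (\<lambda>p. of_real (csum p) * (of_real (green (12 - z) p) * 0)))"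
    by (rule resolvent_equation_form[OF w _ f2 one_le_numeral eq]) simp
  have v: "v = of_real (\<mu>\<^sub>2 / 6) * (u * of_real (gB (12 - z)))" using uv(2) by (simp only: mult_zero_right cavg_const add_0)
  show thesis
  proof (rule that)
    show "AE p in T3. f p = u * of_real (green (12 - z) p + \<mu>\<^sub>2 / 6 * gB (12 - z))"
      using uv(1) unfolding v by (simp add: algebra_simps)
    show "u * of_real (Delta \<mu>\<^sub>1 \<mu>\<^sub>2 (12 - z)) = 0"
      using uv(3) by (simp only: mult_zero_right cavg_const add_0 neg_equal_zero) simp
  qed
qed

lemma threshold_solution:
  assumes w: "w \<ge> 12" and D: "Delta \<mu>\<^sub>1 \<mu>\<^sub>2 w = 0" and r: "r \<ge> 1"
    and f: "(\<lambda>p. of_real (green w p + \<mu>\<^sub>2 / 6 * gB w)) \<in> Lr_even_sym r" (is "?f \<in> _")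
  shows "AE p in T3. H \<mu>\<^sub>1 \<mu>\<^sub>2 ?f p = of_real (12 - w) * ?f p"
proof -
  have "AE p in T3. H \<mu>\<^sub>1 \<mu>\<^sub>2 ?f p - of_real (12 - w) * ?f p = 0"
    by (rule resolvent_equation_solution[OF w _ f r, of "\<lambda>_. 0" 1 "of_real (\<mu>\<^sub>2 / 6 * gB w)"])
       (simp_all only: mult_zero_right cavg_const D, simp_all)
  then show ?thesis by simp
qed

lemma eigenvalue_iff_Delta:
  assumes z: "z < 0"
  shows "eigenvalue (H \<mu>\<^sub>1 \<mu>\<^sub>2) L2s z \<longleftrightarrow> Delta \<mu>\<^sub>1 \<mu>\<^sub>2 (12 - z) = 0"
    and "Delta \<mu>\<^sub>1 \<mu>\<^sub>2 (12 - z) = 0 \<Longrightarrow> multiplicity_ev (H \<mu>\<^sub>1 \<mu>\<^sub>2) L2s z = 1"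
proof -
  let ?w = "12 - z"
  define e where "e = (\<lambda>p. complex_of_real (green ?w p + \<mu>\<^sub>2 / 6 * gB ?w))"
  have "(\<lambda>p. 0) \<in> L2s" by (rule Lr_even_symI[of _ "\<lambda>_. 0"]) auto
  from ansatz_in_L2s[OF _ this, of ?w 1 "of_real (\<mu>\<^sub>2 / 6 * gB ?w)"]
  have e: "e \<in> L2s" using z by (simp add: e_def)
  \<comment> \<open>If \<open>e\<close> were null, \<open>green ?w\<close> would be constant almost
    everywhere. Then \<open>?w * gA ?w = 1\<close>, and \<open>gB ?w\<close> would vanish by
    \<open>gB_eq\<close>.\<close>
  have e_nz: "\<not> (AE p in T3. c * e p = 0)" if "c \<noteq> 0" for c
  proof
    assume "AE p in T3. c * e p = 0"
    then have ae: "AE p in T3. green ?w p + \<mu>\<^sub>2 / 6 * gB ?w = 0" using that by (simp add: e_def del: of_real_add)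
    define k where "k = - (\<mu>\<^sub>2 / 6 * gB ?w)"
    have k: "AE p in T3. green ?w p = k" using ae by (simp add: k_def eq_neg_iff_add_eq_0)
    have "AE p in T3. (?w - 4 * csum p) * k = 1"
      using AE_green_cancel[of ?w] z k by auto
    then have "avg (\<lambda>p. (?w - 4 * csum p) * k) = avg (\<lambda>p. 1)" by (intro avg_cong_AE) auto
    moreover have "avg (\<lambda>p. (?w - 4 * csum p) * k) = ?w * k"
    proof -
      have "avg (\<lambda>p. k * (?w - 4 * csum p)) = k * ?w" by (simp only: avg_mult) (simp add: avg_diff)
      then show ?thesis by (simp add: mult.commute)
    qed
    ultimately have wk: "?w * k = 1" by simp
    have "gA ?w = k"
    proof -
      have "avg (green ?w) = avg (\<lambda>p. k)" by (intro avg_cong_AE k) auto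
      then show ?thesis by (simp add: gA_def)
    qed
    then show False using gB_eq[of ?w] gB_pos[of ?w] wk z by simp
  qed
  have e_eig: "e \<in> eigenspace (H \<mu>\<^sub>1 \<mu>\<^sub>2) L2s z" if "Delta \<mu>\<^sub>1 \<mu>\<^sub>2 ?w = 0"
    using threshold_solution[OF _ that, of 2] e z by (simp add: eigenspace_def e_def[abs_def])
  show iff: "eigenvalue (H \<mu>\<^sub>1 \<mu>\<^sub>2) L2s z \<longleftrightarrow> Delta \<mu>\<^sub>1 \<mu>\<^sub>2 ?w = 0"
  proof
    assume "eigenvalue (H \<mu>\<^sub>1 \<mu>\<^sub>2) L2s z"
    then obtain f where f: "f \<in> eigenspace (H \<mu>\<^sub>1 \<mu>\<^sub>2) L2s z" "\<not> (AE p in T3. f p = 0)"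
      by (auto simp: eigenvalue_def)
    obtain u where u: "AE p in T3. f p = u * of_real (green ?w p + \<mu>\<^sub>2 / 6 * gB ?w)" "u * of_real (Delta \<mu>\<^sub>1 \<mu>\<^sub>2 ?w) = 0"
      by (rule eigenspace_L2s_form[OF z f(1)])
    have "u \<noteq> 0" using u(1) f(2) by auto
    then show "Delta \<mu>\<^sub>1 \<mu>\<^sub>2 ?w = 0" using u(2) by simp
  next
    assume "Delta \<mu>\<^sub>1 \<mu>\<^sub>2 ?w = 0"
    then show "eigenvalue (H \<mu>\<^sub>1 \<mu>\<^sub>2) L2s z"
      unfolding eigenvalue_def using e_eig e_nz[of 1] by auto
  qed
  assume D: "Delta \<mu>\<^sub>1 \<mu>\<^sub>2 ?w = 0"
  have "{n. \<exists>f. (\<forall>j<n. f j \<in> eigenspace (H \<mu>\<^sub>1 \<mu>\<^sub>2) L2s z) \<and> lin_indep_ae n f} = {0, 1}" (is "?S = _")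
  proof (intro equalityI subsetI)
    fix n assume "n \<in> ?S"
    then obtain f where f: "\<And>j. j < n \<Longrightarrow> f j \<in> eigenspace (H \<mu>\<^sub>1 \<mu>\<^sub>2) L2s z" and li: "lin_indep_ae n f" by auto
    show "n \<in> {0, 1}"
    proof (rule ccontr)
      assume "n \<notin> {0, 1}"
      then have n: "0 < n" "1 < n" by auto
      have ex: "\<exists>u. AE p in T3. f j p = u * e p" if "j < n" for j
        using eigenspace_L2s_form[OF z f[OF that]] unfolding e_def by metis
      obtain a where a: "AE p in T3. f 0 p = a * e p" using ex n by blast
      obtain b where b: "AE p in T3. f 1 p = b * e p" using ex n by blast
      have lin: "(\<forall>j<n. c j = 0)" if "AE p in T3. (\<Sum>j<n. c j * f j p) = 0" for c
        using li that by (simp add: lin_indep_ae_def)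
      have two: "(\<Sum>j<n. (if j = 0 then x else if j = 1 then y else 0) * f j p) = x * f 0 p + y * f 1 p" for x y p
      proof -
        have "(\<Sum>j<n. (if j = 0 then x else if j = 1 then y else 0) * f j p)
          = (\<Sum>j\<in>{0, 1}. (if j = 0 then x else if j = 1 then y else 0) * f j p)"
          by (rule sum.mono_neutral_right) (use n in auto)
        then show ?thesis by simp
      qed
      \<comment> \<open>With \<open>f 0\<close> and \<open>f 1\<close> equal to \<open>a\<close> and
        \<open>b\<close> times \<open>e\<close>, the coefficients \<open>b\<close> and
        \<open>- a\<close> cancel. Independence forces \<open>a = 0\<close>, so \<open>f 0\<close>
        is null, and the coefficients \<open>1\<close> and \<open>0\<close> give the
        contradiction.\<close>
      have "AE p in T3. (\<Sum>j<n. (if j = 0 then b else if j = 1 then - a else 0) * f j p) = 0"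
        using a b unfolding two by eventually_elim simp
      from lin[OF this] have "a = 0" using n by (metis neg_equal_0_iff_equal zero_neq_one)
      then have "AE p in T3. (\<Sum>j<n. (if j = 0 then 1 else if j = 1 then 0 else 0) * f j p) = 0"
        using a unfolding two by simp
      from lin[OF this] show False using n by (metis zero_neq_one)
    qed
  next
    fix n :: nat assume "n \<in> {0, 1}"
    moreover have "lin_indep_ae 0 (\<lambda>_. e)" by (simp add: lin_indep_ae_def)
    moreover have "lin_indep_ae 1 (\<lambda>_. e)" using e_nz by (auto simp: lin_indep_ae_def)
    ultimately show "n \<in> ?S" using e_eig[OF D] by (intro CollectI exI[of _ "\<lambda>_. e"]) auto
  qed
  then have "multiplicity_ev (H \<mu>\<^sub>1 \<mu>\<^sub>2) L2s z = (SUP n\<in>{0, 1}. enat n)"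
    by (simp add: multiplicity_ev_def)
  then show "multiplicity_ev (H \<mu>\<^sub>1 \<mu>\<^sub>2) L2s z = 1"
    by (simp add: one_enat_def sup_max)
qed

section \<open>Location of the spectrum\<close>

lemma eigenvalue_in_spectrum:
  assumes "eigenvalue A L2s e" shows "e \<in> spectrum A L2s"
proof (rule ccontr)
  assume "e \<notin> spectrum A L2s"
  then obtain C where C: "\<And>f. f \<in> L2s \<Longrightarrow> L2norm f \<le> C * L2norm (\<lambda>p. A f p - of_real e * f p)"
    by (auto simp: spectrum_def resolvent_set_def)
  obtain f where f: "f \<in> L2s" "AE p in T3. A f p = of_real e * f p" "\<not> (AE p in T3. f p = 0)"
    using assms by (auto simp: eigenvalue_def eigenspace_def)
  have "L2norm (\<lambda>p. A f p - of_real e * f p) = 0" by (rule L2norm_AE_0) (use f in simp)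
  then have "L2norm f \<le> 0" using C[OF f(1)] by simp
  then show False using AE_L2norm_eq_0 f by blast
qed

lemma negative_spectrum_iff:
  assumes "z < 0"
  shows "z \<in> spectrum (H \<mu>\<^sub>1 \<mu>\<^sub>2) L2s \<longleftrightarrow> 12 - z \<in> roots \<mu>\<^sub>1 \<mu>\<^sub>2"
    and "eigenvalue (H \<mu>\<^sub>1 \<mu>\<^sub>2) L2s z \<longleftrightarrow> 12 - z \<in> roots \<mu>\<^sub>1 \<mu>\<^sub>2"
proof -
  have r: "Delta \<mu>\<^sub>1 \<mu>\<^sub>2 (12 - z) = 0 \<longleftrightarrow> 12 - z \<in> roots \<mu>\<^sub>1 \<mu>\<^sub>2"
    using assms Delta_eq_0_iff[of "12 - z"] by (simp add: roots_def)
  show "eigenvalue (H \<mu>\<^sub>1 \<mu>\<^sub>2) L2s z \<longleftrightarrow> 12 - z \<in> roots \<mu>\<^sub>1 \<mu>\<^sub>2"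
    using eigenvalue_iff_Delta(1)[OF assms] r by simp
  then show "z \<in> spectrum (H \<mu>\<^sub>1 \<mu>\<^sub>2) L2s \<longleftrightarrow> 12 - z \<in> roots \<mu>\<^sub>1 \<mu>\<^sub>2"
    using resolvent_set_below[OF assms] r eigenvalue_in_spectrum by (auto simp: spectrum_def)
qed

text \<open>A layer between two levels of \<open>csum\<close>: \<open>E0\<close> is nearly constant
  on a thin one, and on the torus its indicator is a function of \<open>csum\<close>, hence even and
  symmetric.\<close>

definition shell :: "real \<Rightarrow> real \<Rightarrow> (real^3) set" where
  "shell a b = {p \<in> torus. a < csum p \<and> csum p < b}"

lemma sets_shell [measurable]: "shell a b \<in> sets T3"
proof -
  have "{p \<in> space T3. a < csum p \<and> csum p < b} \<in> sets T3" by measurable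
  then show ?thesis by (simp add: shell_def)
qed

lemma csum_level_ex:
  assumes "-3 < s" "s < 3"
  obtains x where "csum x = s" "\<And>i. - pi < x $ i \<and> x $ i < pi"
proof -
  define t where "t = arccos (s / 3)"
  have t: "0 < t" "t < pi" "cos t = s / 3"
    unfolding t_def using assms arccos_lt_bounded[of "s / 3"] by (auto simp: cos_arccos)
  show thesis
  proof (rule that[of "\<chi> i. t"])
    show "csum (\<chi> i. t) = s" by (simp add: csum_def t)
    show "- pi < (\<chi> i. t) $ i \<and> (\<chi> i. t) $ i < pi" for i :: 3 using t by simp
  qed
qed

lemma shell_nonnull:
  assumes "-3 \<le> a" "a < b" "b \<le> 3"
  shows "measure T3 (shell a b) > 0"
    and "AE p in T3. P p \<Longrightarrow> \<exists>p \<in> {p. a < csum p \<and> csum p < b}. P p"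
proof -
  obtain x where x: "csum x = (a + b) / 2" "\<And>i. - pi < x $ i \<and> x $ i < pi"
    using csum_level_ex[of "(a + b) / 2"] assms by auto
  have o: "open {p. a < csum p \<and> csum p < b}"
    by (intro open_Collect_conj open_Collect_less continuous_csum continuous_on_const)
  have xin: "x \<in> {p. a < csum p \<and> csum p < b}" using x assms by simp
  have "shell a b = {p. a < csum p \<and> csum p < b} \<inter> torus" by (auto simp: shell_def)
  then show "measure T3 (shell a b) > 0" using measure_T3_pos[OF o xin x(2)] by simp
  show "AE p in T3. P p \<Longrightarrow> \<exists>p \<in> {p. a < csum p \<and> csum p < b}. P p"
    using AE_T3_ex[OF _ o xin x(2)] by blast
qed

lemma shell_moment_bounds:
  "a * measure T3 (shell a b) \<le> (LINT p|T3. csum p * indicator (shell a b) p)"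
  "(LINT p|T3. csum p * indicator (shell a b) p) \<le> b * measure T3 (shell a b)"
proof -
  have i: "integrable T3 (\<lambda>p. c * indicator (shell a b) p :: real)" for c
    by (intro integrable_mult_right T3.integrable_const_bound[of _ 1]) (auto simp: indicator_def)
  have j: "integrable T3 (\<lambda>p. csum p * indicator (shell a b) p)"
    using integrable_csum_power_mult[of "indicator (shell a b)" 1] i[of 1] by simp
  have c: "(LINT p|T3. c * indicator (shell a b) p) = c * measure T3 (shell a b)" for c :: real
  proof -
    have "shell a b \<inter> torus = shell a b" by (auto simp: shell_def)
    then show ?thesis by simp
  qed
  have "(LINT p|T3. a * indicator (shell a b) p) \<le> (LINT p|T3. csum p * indicator (shell a b) p)"
    by (intro integral_mono i j) (auto simp: indicator_def shell_def)
  then show "a * measure T3 (shell a b) \<le> (LINT p|T3. csum p * indicator (shell a b) p)" by (simp only: c)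
  have "(LINT p|T3. csum p * indicator (shell a b) p) \<le> (LINT p|T3. b * indicator (shell a b) p)"
    by (intro integral_mono i j) (auto simp: indicator_def shell_def)
  then show "(LINT p|T3. csum p * indicator (shell a b) p) \<le> b * measure T3 (shell a b)" by (simp only: c)
qed

text \<open>
  Three disjoint shells carry a non-zero combination of indicators orthogonal to \<open>1\<close> and \<open>csum\<close>,
  on which the rank two perturbation vanishes.
\<close>

lemma interval_in_spectrum:
  assumes z: "0 \<le> z" "z < 24"
  shows "z \<in> spectrum (H \<mu>\<^sub>1 \<mu>\<^sub>2) L2s"
proof (rule ccontr)
  assume "z \<notin> spectrum (H \<mu>\<^sub>1 \<mu>\<^sub>2) L2s"
  then obtain C where C: "\<And>f. f \<in> L2s \<Longrightarrow> L2norm f \<le> C * L2norm (\<lambda>p. H \<mu>\<^sub>1 \<mu>\<^sub>2 f p - of_real z * f p)"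
    by (auto simp: spectrum_def resolvent_set_def)
  define s where "s = (12 - z) / 4"
  have s: "-3 < s" "s \<le> 3" using z by (auto simp: s_def)
  \<comment> \<open>The first bound fits five widths below \<open>s\<close> into the range of
    \<open>csum\<close>. The second gives \<open>\<bar>C\<bar> * (20 * \<delta>) < 1\<close>, where
    \<open>20 * \<delta>\<close> bounds \<open>4 * (s - csum p)\<close> on the support of the trial
    function.\<close>
  define \<delta> where "\<delta> = min ((s + 3) / 5) (1 / (21 * (\<bar>C\<bar> + 1)))"
  have d0: "\<delta> > 0" using s by (simp add: \<delta>_def)
  have ds: "s - 5 * \<delta> \<ge> -3" using min.cobounded1[of "(s + 3) / 5"] by (simp add: \<delta>_def field_simps)
  have dC: "\<bar>C\<bar> * (20 * \<delta>) < 1"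
  proof -
    have "\<delta> \<le> 1 / (21 * (\<bar>C\<bar> + 1))" by (simp add: \<delta>_def)
    then have "\<delta> * (21 * (\<bar>C\<bar> + 1)) \<le> 1" by (simp add: pos_le_divide_eq)
    then have "\<bar>C\<bar> * (20 * \<delta>) + (\<bar>C\<bar> * \<delta> + 21 * \<delta>) \<le> 1" by (simp add: algebra_simps)
    moreover have "\<bar>C\<bar> * \<delta> + 21 * \<delta> > 0" using d0 by (intro add_nonneg_pos) auto
    ultimately show ?thesis by linarith
  qed
  \<comment> \<open>The layers lie below \<open>s\<close>, so \<open>s = 3\<close>, the energy zero,
    is allowed. The gap between the last two separates their mean values of \<open>csum\<close> by
    at least \<open>\<delta>\<close>, which makes \<open>c 0\<close> positive.\<close>
  define B where "B = (\<lambda>k::nat. shell (s - (2 * k + 1) * \<delta>) (s - 2 * k * \<delta>))"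
  define m where "m = (\<lambda>k. measure T3 (B k))"
  define e where "e = (\<lambda>k. LINT p|T3. csum p * indicator (B k) p)"
  have [measurable]: "B k \<in> sets T3" for k by (simp add: B_def)
  have m: "m 0 > 0" "m 1 > 0" "m 2 > 0"
    unfolding m_def B_def using s d0 ds by (auto intro!: shell_nonnull(1) simp: algebra_simps)
  \<comment> \<open>The cross product of the vectors \<open>e\<close> and \<open>m\<close>,
    orthogonal to both.\<close>
  define c where "c = (\<lambda>k::nat. if k = 0 then m 2 * e 1 - m 1 * e 2
      else if k = 1 then m 0 * e 2 - m 2 * e 0 else m 1 * e 0 - m 0 * e 1)"
  have c0: "c 0 > 0"
  proof -
    have "(s - 3 * \<delta>) * m 1 \<le> e 1" using shell_moment_bounds(1) by (simp add: m_def e_def B_def)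
    moreover have "e 2 \<le> (s - 4 * \<delta>) * m 2" using shell_moment_bounds(2) by (simp add: m_def e_def B_def)
    ultimately have "m 2 * ((s - 3 * \<delta>) * m 1) - m 1 * ((s - 4 * \<delta>) * m 2) \<le> c 0"
      using m by (simp add: c_def) (intro diff_mono mult_left_mono, auto)
    moreover have "m 2 * ((s - 3 * \<delta>) * m 1) - m 1 * ((s - 4 * \<delta>) * m 2) = \<delta> * (m 1 * m 2)"
      by (simp add: algebra_simps)
    ultimately show ?thesis using d0 m by (smt (verit) mult_pos_pos)
  qed
  define \<phi> where "\<phi> = (\<lambda>p. c 0 * indicator (B 0) p + c 1 * indicator (B 1) p + c 2 * indicator (B 2) p)"
  have i: "integrable T3 (\<lambda>p. c k * indicator (B k) p :: real)" for k
    by (intro integrable_mult_right T3.integrable_const_bound[of _ 1]) (auto simp: indicator_def)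
  have j: "integrable T3 (\<lambda>p. c k * (csum p * indicator (B k) p))" for k
    using integrable_csum_power_mult[OF i[of k], of 1] by (simp add: mult.left_commute)
  have [simp]: "B k \<inter> torus = B k" for k by (auto simp: B_def shell_def)
  have int1: "(LINT p|T3. \<phi> p) = 0"
  proof -
    have "(LINT p|T3. \<phi> p) = c 0 * m 0 + c 1 * m 1 + c 2 * m 2"
      unfolding \<phi>_def using i by (simp add: m_def)
    then show ?thesis by (simp add: c_def algebra_simps)
  qed
  have int2: "(LINT p|T3. csum p * \<phi> p) = 0"
  proof -
    have "(LINT p|T3. csum p * \<phi> p) = (LINT p|T3. c 0 * (csum p * indicator (B 0) p) + c 1 * (csum p * indicator (B 1) p) + c 2 * (csum p * indicator (B 2) p))"
      unfolding \<phi>_def by (simp add: algebra_simps)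
    also have "\<dots> = c 0 * e 0 + c 1 * e 1 + c 2 * e 2" using j by (simp add: e_def)
    also have "\<dots> = 0" by (simp add: c_def algebra_simps)
    finally show ?thesis .
  qed
  \<comment> \<open>The indicators are rewritten as functions of the value of \<open>csum\<close>,
    so that \<open>f\<close> has the form required for symmetry at every point. On the torus it
    agrees with \<open>\<phi>\<close>.\<close>
  define I where "I = (\<lambda>k x. if s - (2 * real k + 1) * \<delta> < x \<and> x < s - 2 * real k * \<delta> then 1 else 0 :: real)"
  define F where "F = (\<lambda>x. complex_of_real (c 0 * I 0 x + c 1 * I 1 x + c 2 * I 2 x))"
  define f where "f = (\<lambda>p. F (csum p))"
  have f\<phi>: "f p = of_real (\<phi> p)" if "p \<in> torus" for p
    using that by (simp add: f_def F_def \<phi>_def I_def B_def shell_def indicator_def)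
  have [measurable]: "\<phi> \<in> borel_measurable T3" unfolding \<phi>_def by measurable
  have fm [measurable]: "f \<in> borel_measurable T3"
  proof -
    have "(\<lambda>p. complex_of_real (\<phi> p)) \<in> borel_measurable T3" by measurable
    then show ?thesis by (rule measurable_cong[THEN iffD1, rotated]) (simp add: f\<phi>)
  qed
  have f_L2: "f \<in> L2s"
  proof (rule Lr_even_symI[OF f_def fm])
    have "norm (f p) \<le> \<bar>c 0\<bar> + \<bar>c 1\<bar> + \<bar>c 2\<bar>" for p
      unfolding f_def F_def norm_of_real by (auto simp: I_def)
    then have "(norm (f p))\<^sup>2 \<le> (\<bar>c 0\<bar> + \<bar>c 1\<bar> + \<bar>c 2\<bar>)\<^sup>2" for p by (intro power_mono) auto
    then show "integrable T3 (\<lambda>p. (norm (f p))\<^sup>2)"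
      by (intro T3.integrable_const_bound[of _ "(\<bar>c 0\<bar> + \<bar>c 1\<bar> + \<bar>c 2\<bar>)\<^sup>2"]) auto
  qed
  have "cavg f = 0"
  proof -
    have "cavg f = cavg (\<lambda>p. of_real (\<phi> p))" by (rule cavg_cong_AE) (auto intro!: AE_I2 simp: f\<phi>)
    then show ?thesis by (simp add: avg_def int1)
  qed
  moreover have "cavg (\<lambda>p. of_real (csum p) * f p) = 0"
  proof -
    have "cavg (\<lambda>p. of_real (csum p) * f p) = cavg (\<lambda>p. of_real (csum p * \<phi> p))"
      by (rule cavg_cong_AE) (auto intro!: AE_I2 simp: f\<phi>)
    then show ?thesis by (simp add: avg_def int2 del: of_real_mult)
  qed
  ultimately have Hf: "H \<mu>\<^sub>1 \<mu>\<^sub>2 f p - of_real z * f p = of_real (4 * (s - csum p)) * f p" for p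
    using H_sym[OF f_L2, of \<mu>\<^sub>1 \<mu>\<^sub>2 p] by (simp add: E0_eq s_def algebra_simps)
  have "L2norm (\<lambda>p. H \<mu>\<^sub>1 \<mu>\<^sub>2 f p - of_real z * f p) \<le> (20 * \<delta>) * L2norm f"
    unfolding Hf
  proof (rule L2norm_mono[OF Lr_even_sym_integrable_power[OF f_L2]])
    show "AE p in T3. norm (of_real (4 * (s - csum p)) * f p) \<le> 20 * \<delta> * norm (f p)"
    proof (intro AE_I2)
      fix p
      show "norm (of_real (4 * (s - csum p)) * f p) \<le> 20 * \<delta> * norm (f p)"
      proof (cases "f p = 0")
        case False
        have "\<exists>k\<in>{0, 1, 2}. I k (csum p) \<noteq> 0"
          by (rule ccontr) (use False in \<open>simp add: f_def F_def\<close>)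
        then obtain k where k: "k \<in> {0, 1, 2}" "I k (csum p) \<noteq> 0" by blast
        then have "s - 5 * \<delta> \<le> csum p \<and> csum p \<le> s"
          using d0 by (auto simp: I_def split: if_splits)
        then have "\<bar>4 * (s - csum p)\<bar> \<le> 20 * \<delta>" by auto
        then show ?thesis unfolding norm_mult norm_of_real by (rule mult_right_mono) simp
      qed simp
    qed
  qed (use d0 in simp_all)
  then have "\<bar>C\<bar> * L2norm (\<lambda>p. H \<mu>\<^sub>1 \<mu>\<^sub>2 f p - of_real z * f p) \<le> \<bar>C\<bar> * (20 * \<delta>) * L2norm f"
    by (simp add: mult_left_mono mult.assoc)
  moreover have "L2norm f \<le> \<bar>C\<bar> * L2norm (\<lambda>p. H \<mu>\<^sub>1 \<mu>\<^sub>2 f p - of_real z * f p)"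
    using C[OF f_L2] by (rule order_trans) (intro mult_right_mono, auto simp: L2norm_def)
  ultimately have "(1 - \<bar>C\<bar> * (20 * \<delta>)) * L2norm f \<le> 0" by (simp add: algebra_simps)
  then have "L2norm f \<le> 0" using dC by (simp add: mult_le_0_iff)
  then have "AE p in T3. f p = 0" using AE_L2norm_eq_0 f_L2 by blast
  then have "\<exists>p \<in> {p. s - \<delta> < csum p \<and> csum p < s}. f p = 0"
    by (rule shell_nonnull(2)[rotated 3]) (use s d0 ds in auto)
  then obtain p where "s - \<delta> < csum p" "csum p < s" "f p = 0" by auto
  then have "c 0 = 0" using d0 by (auto simp: f_def F_def I_def split: if_splits)
  then show False using c0 by simp
qed

lemma finite_negative_roots: "finite {z. z < 0 \<and> 12 - z \<in> roots \<mu>\<^sub>1 \<mu>\<^sub>2}"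
  and card_negative_roots: "card {z. z < 0 \<and> 12 - z \<in> roots \<mu>\<^sub>1 \<mu>\<^sub>2} = card (roots \<mu>\<^sub>1 \<mu>\<^sub>2)"
proof -
  have eq: "{z. z < 0 \<and> 12 - z \<in> roots \<mu>\<^sub>1 \<mu>\<^sub>2} = (\<lambda>w. 12 - w) ` roots \<mu>\<^sub>1 \<mu>\<^sub>2"
  proof (intro equalityI subsetI)
    fix z assume "z \<in> {z. z < 0 \<and> 12 - z \<in> roots \<mu>\<^sub>1 \<mu>\<^sub>2}"
    then show "z \<in> (\<lambda>w. 12 - w) ` roots \<mu>\<^sub>1 \<mu>\<^sub>2" by (intro image_eqI[of _ _ "12 - z"]) auto
  qed (auto simp: roots_def)
  show "finite {z. z < 0 \<and> 12 - z \<in> roots \<mu>\<^sub>1 \<mu>\<^sub>2}" unfolding eq by (intro finite_imageI finite_roots)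
  show "card {z. z < 0 \<and> 12 - z \<in> roots \<mu>\<^sub>1 \<mu>\<^sub>2} = card (roots \<mu>\<^sub>1 \<mu>\<^sub>2)"
    unfolding eq by (rule card_image) (auto simp: inj_on_def)
qed

lemma essential_spectrum_nonneg:
  assumes "z \<in> essential_spectrum (H \<mu>\<^sub>1 \<mu>\<^sub>2) L2s"
  shows "z \<ge> 0"
proof (rule ccontr)
  assume "\<not> z \<ge> 0"
  then have z: "z < 0" by simp
  let ?N = "{z. z < 0 \<and> 12 - z \<in> roots \<mu>\<^sub>1 \<mu>\<^sub>2}"
  have zs: "z \<in> spectrum (H \<mu>\<^sub>1 \<mu>\<^sub>2) L2s" using assms by (simp add: essential_spectrum_def)
  then have zr: "12 - z \<in> roots \<mu>\<^sub>1 \<mu>\<^sub>2" using negative_spectrum_iff[OF z] by simp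
  have "open ({..<0} - (?N - {z}))"
    by (intro open_Diff finite_imp_closed finite_Diff finite_negative_roots) auto
  moreover have "({..<0} - (?N - {z})) \<inter> spectrum (H \<mu>\<^sub>1 \<mu>\<^sub>2) L2s = {z}"
    using z zs negative_spectrum_iff(1) by auto
  ultimately have "z isolated_in spectrum (H \<mu>\<^sub>1 \<mu>\<^sub>2) L2s"
    unfolding isolated_in_def using zs by blast
  moreover have ev: "eigenvalue (H \<mu>\<^sub>1 \<mu>\<^sub>2) L2s z" using negative_spectrum_iff[OF z] zr by simp
  moreover have "multiplicity_ev (H \<mu>\<^sub>1 \<mu>\<^sub>2) L2s z = 1"
    using eigenvalue_iff_Delta[OF z] ev by simp
  ultimately have "z \<in> discrete_spectrum (H \<mu>\<^sub>1 \<mu>\<^sub>2) L2s"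
    by (simp add: discrete_spectrum_def one_enat_def)
  then show False using assms by (simp add: essential_spectrum_def)
qed

text \<open>Zero is an accumulation point of the spectrum from the right, hence not discrete,
  whether or not it is an eigenvalue.\<close>

lemma zero_in_essential_spectrum: "0 \<in> essential_spectrum (H \<mu>\<^sub>1 \<mu>\<^sub>2) L2s"
proof -
  have "\<not> 0 isolated_in spectrum (H \<mu>\<^sub>1 \<mu>\<^sub>2) L2s"
  proof
    assume "0 isolated_in spectrum (H \<mu>\<^sub>1 \<mu>\<^sub>2) L2s"
    then obtain T where T: "open T" "T \<inter> spectrum (H \<mu>\<^sub>1 \<mu>\<^sub>2) L2s = {0}" by (auto simp: isolated_in_def)
    then obtain r where r: "r > 0" "ball 0 r \<subseteq> T" by (metis IntD1 insertI1 open_contains_ball)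
    define x where "x = min (r / 2) 1"
    have x: "0 < x" "x < r" "x < 24" using r by (auto simp: x_def)
    then have "x \<in> T" using r by auto
    moreover have "x \<in> spectrum (H \<mu>\<^sub>1 \<mu>\<^sub>2) L2s" using interval_in_spectrum x by simp
    ultimately have "x \<in> {0}" using T(2) by blast
    then show False using x by simp
  qed
  then show ?thesis using interval_in_spectrum[of 0] by (simp add: essential_spectrum_def discrete_spectrum_def)
qed

lemma Inf_essential_spectrum: "Inf (essential_spectrum (H \<mu>\<^sub>1 \<mu>\<^sub>2) L2s) = 0"
  by (rule cInf_eq_minimum[OF zero_in_essential_spectrum essential_spectrum_nonneg])

text \<open>Zero is the least point of the essential spectrum, so exactly the negative eigenvalues
  count. They are simple and finitely many, and the supremum over finite subsets is attained at the
  full set.\<close>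

lemma n_minus_sym_eq: "n_minus_sym \<mu>\<^sub>1 \<mu>\<^sub>2 = enat (card (roots \<mu>\<^sub>1 \<mu>\<^sub>2))"
proof -
  let ?N = "{z. z < 0 \<and> 12 - z \<in> roots \<mu>\<^sub>1 \<mu>\<^sub>2}"
  have eb: "eigenvalues_below_ess (H \<mu>\<^sub>1 \<mu>\<^sub>2) L2s = ?N"
    unfolding eigenvalues_below_ess_def
    using zero_in_essential_spectrum essential_spectrum_nonneg negative_spectrum_iff(2)
    by (auto intro: less_le_trans)
  have mult: "(\<Sum>e\<in>F. multiplicity_ev (H \<mu>\<^sub>1 \<mu>\<^sub>2) L2s e) = enat (card F)" if "F \<subseteq> ?N" for F
  proof -
    have "multiplicity_ev (H \<mu>\<^sub>1 \<mu>\<^sub>2) L2s e = 1" if "e \<in> F" for e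
      using that \<open>F \<subseteq> ?N\<close> eigenvalue_iff_Delta[of e] negative_spectrum_iff(2)[of e] by auto
    then have "(\<Sum>e\<in>F. multiplicity_ev (H \<mu>\<^sub>1 \<mu>\<^sub>2) L2s e) = (\<Sum>e\<in>F. 1)" by (intro sum.cong) auto
    then show ?thesis by (simp add: of_nat_eq_enat)
  qed
  have "n_minus_sym \<mu>\<^sub>1 \<mu>\<^sub>2 = (SUP F\<in>{F. finite F \<and> F \<subseteq> ?N}. \<Sum>e\<in>F. multiplicity_ev (H \<mu>\<^sub>1 \<mu>\<^sub>2) L2s e)"
    by (simp only: n_minus_sym_def n_minus_def eb)
  also have "\<dots> = (SUP F\<in>{F. finite F \<and> F \<subseteq> ?N}. enat (card F))"
    by (intro SUP_cong refl mult) auto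
  also have "\<dots> = enat (card ?N)"
  proof (rule antisym)
    show "(SUP F\<in>{F. finite F \<and> F \<subseteq> ?N}. enat (card F)) \<le> enat (card ?N)"
      by (intro SUP_least) (auto intro!: card_mono finite_negative_roots)
    show "enat (card ?N) \<le> (SUP F\<in>{F. finite F \<and> F \<subseteq> ?N}. enat (card F))"
      by (rule SUP_upper) (simp add: finite_negative_roots)
  qed
  finally show ?thesis by (simp only: card_negative_roots)
qed

lemma E_min_eq: "E_min = 0"
  unfolding E_min_def
proof (rule cInf_eq_minimum)
  have "E0 0 = 0" by (simp add: E0_def)
  moreover have "(0::real^3) \<in> torus" by (simp add: mem_torus)
  ultimately show "0 \<in> E0 ` torus" by force
qed (use E0_nonneg in auto)

text \<open>At \<open>w = 12\<close> the function \<open>green\<close> is \<open>1 / E0\<close>,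
  integrable but not square integrable. On a space of finite measure the added constant
  \<open>t\<close> changes neither property.\<close>

lemma threshold_resonance:
  assumes "Delta \<mu>\<^sub>1 \<mu>\<^sub>2 12 = 0"
  shows "threshold_resonance_sym \<mu>\<^sub>1 \<mu>\<^sub>2"
proof -
  define t where "t = \<mu>\<^sub>2 / 6 * gB 12"
  define f where "f = (\<lambda>p. complex_of_real (green 12 p + t))"
  have fm [measurable]: "f \<in> borel_measurable T3" unfolding f_def by measurable
  have green: "green 12 p = 1 / E0 p" for p by (simp add: green_def E0_eq)
  have "f \<in> Lr_even_sym 1"
  proof (rule Lr_even_symI[OF _ fm])
    show "f = (\<lambda>p. (\<lambda>c. complex_of_real (1 / (12 - 4 * c) + t)) (csum p))" by (simp add: f_def green_def)
    have "integrable T3 f" unfolding f_def using integrable_green[of 12] by simp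
    then show "integrable T3 (\<lambda>p. norm (f p) ^ 1)" by simp
  qed
  moreover from this have "AE p in T3. H \<mu>\<^sub>1 \<mu>\<^sub>2 f p = of_real E_min * f p"
    using threshold_solution[OF order_refl assms, of 1] by (simp add: f_def t_def E_min_eq)
  moreover have "f \<notin> Lr_even_sym 2"
  proof
    assume "f \<in> Lr_even_sym 2"
    then have "integrable T3 (\<lambda>p. (norm (f p))\<^sup>2)" by (rule Lr_even_sym_integrable_power)
    then have "integrable T3 (\<lambda>p. (norm (complex_of_real (green 12 p)))\<^sup>2)"
    proof (rule integrable_norm_sq_bound)
      show "AE p in T3. norm (complex_of_real (green 12 p)) \<le> 1 * norm (f p) + \<bar>t\<bar>"
      proof (intro AE_I2)
        fix p
        have "\<bar>green 12 p\<bar> \<le> \<bar>green 12 p + t\<bar> + \<bar>t\<bar>" by arith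
        then show "norm (complex_of_real (green 12 p)) \<le> 1 * norm (f p) + \<bar>t\<bar>"
          unfolding f_def norm_of_real by simp
      qed
    qed measurable
    then show False using not_integrable_inverse_E0_squared by (simp add: green norm_divide power_divide)
  qed
  ultimately show ?thesis unfolding threshold_resonance_sym_def by blast
qed

theorem theorem4p8:
  fixes i :: nat and \<mu>\<^sub>1\<^sub>0 \<mu>\<^sub>2\<^sub>0 :: real
  assumes "i \<in> {0, 1}"
    and "(\<mu>\<^sub>1\<^sub>0, \<mu>\<^sub>2\<^sub>0) \<in> \<tau>_minus i"
  shows "((\<lambda>(\<mu>\<^sub>1, \<mu>\<^sub>2). n_minus_sym \<mu>\<^sub>1 \<mu>\<^sub>2) \<longlongrightarrow> enat i)
           (at (\<mu>\<^sub>1\<^sub>0, \<mu>\<^sub>2\<^sub>0) within A_minus i)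
    \<and> ((\<lambda>(\<mu>\<^sub>1, \<mu>\<^sub>2). n_minus_sym \<mu>\<^sub>1 \<mu>\<^sub>2) \<longlongrightarrow> enat (i + 1))
           (at (\<mu>\<^sub>1\<^sub>0, \<mu>\<^sub>2\<^sub>0) within A_minus (i + 1))
    \<and> n_minus_sym \<mu>\<^sub>1\<^sub>0 \<mu>\<^sub>2\<^sub>0 = enat i
    \<and> E_min = Inf (essential_spectrum (H \<mu>\<^sub>1\<^sub>0 \<mu>\<^sub>2\<^sub>0) (Lr_even_sym 2))
    \<and> E_min = 0
    \<and> threshold_resonance_sym \<mu>\<^sub>1\<^sub>0 \<mu>\<^sub>2\<^sub>0"
proof -
  \<comment> \<open>The count equals \<open>k\<close> at every point of the region, so the limit is
    that of a constant, wherever it is taken.\<close>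
  have lim: "((\<lambda>(\<mu>\<^sub>1, \<mu>\<^sub>2). n_minus_sym \<mu>\<^sub>1 \<mu>\<^sub>2) \<longlongrightarrow> enat k) (at x within A_minus k)" for k x
  proof (rule tendsto_eventually)
    show "\<forall>\<^sub>F y in at x within A_minus k. (case y of (\<mu>\<^sub>1, \<mu>\<^sub>2) \<Rightarrow> n_minus_sym \<mu>\<^sub>1 \<mu>\<^sub>2) = enat k"
      unfolding eventually_at_filter
      by (rule always_eventually) (auto simp: n_minus_sym_eq card_roots_A)
  qed
  have "threshold_resonance_sym \<mu>\<^sub>1\<^sub>0 \<mu>\<^sub>2\<^sub>0"
    using card_roots_tau(2)[OF assms(2)] by (intro threshold_resonance) (simp add: Delta_eq_0_iff)
  then show ?thesis
    using lim card_roots_tau(1)[OF assms(2)] by (simp only: n_minus_sym_eq E_min_eq Inf_essential_spectrum simp_thms)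
qed

end
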